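(* Let $n\ge3$, $\alpha\in(0,n)$, $p,q>0$ with $pq>1$, and let $u,v$ be bounded positive solutions on $\mathbb{R}^n$ of $$u(x)=\int_{\mathbb{R}^n}\frac{v^q(y)\,dy}{|x-y|^{n-\alpha}},\qquad v(x)=\int_{\mathbb{R}^n}\frac{u^p(y)\,dy}{|x-y|^{n-\alpha}}.$$ Suppose there exist $\theta_1,\theta_2>0$ such that $u(x)\simeq(1+|x|)^{-\theta_1}$ and $v(x)\simeq(1+|x|)^{-\theta_2}$ as $|x|\to\infty$. Then $\frac{1}{p+1}+\frac{1}{q+1}\le\frac{n-\alpha}{n}$, and $$\theta_1\ge\frac{\alpha(q+1)}{pq-1},\qquad \theta_2\ge\frac{\alpha(p+1)}{pq-1}.$$ Furthermore: (1) if at least one of these two inequalities is strict, then $\frac{1}{p+1}+\frac{1}{q+1}=\frac{n-\alpha}{n}$, $(u,v)\in L^{p+1}(\mathbb{R}^n)\times L^{q+1}(\mathbb{R}^n)$, and $u,v$ decay fast in the following sense: if $p\le q$, then $u(x)\simeq|x|^{\alpha-n}$, and $v(x)\simeq|x|^{\alpha-n}$ if $p(n-\alpha)>n$, $v(x)\simeq|x|^{\alpha-n}\ln|x|$ if $p(n-\alpha)=n$, $v(x)\simeq|x|^{(\alpha-n)(p+1)+n}$ if $p(n-\alpha)<n$; if $q\le p$, the same holds with the roles of $(u,p)$ and $(v,q)$ interchanged. (2) if $\frac{1}{p+1}+\frac{1}{q+1}<\frac{n-\alpha}{n}$, then $\theta_1=\frac{\alpha(q+1)}{pq-1}$ and 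$\theta_2=\frac{\alpha(p+1)}{pq-1}$.
   Context: Positive solutions are positive measurable functions satisfying both integral identities (finite) at every point. "$f(x)\simeq g(x)$ as $|x|\to\infty$" means there is $C>0$ with $g(x)/C\le f(x)\le Cg(x)$ for all sufficiently large $|x|$. *)

theory Defs
  imports "HOL-Analysis.Analysis"
begin

definition riesz_pot :: "real \<Rightarrow> (real^'n \<Rightarrow> real) \<Rightarrow> real^'n \<Rightarrow> real" where
  "riesz_pot \<alpha> f x = (\<integral>y. f y / norm (x - y) powr (real CARD('n) - \<alpha>) \<partial>lborel)"

definition pos_solution :: "real \<Rightarrow> real \<Rightarrow> real \<Rightarrow> (real^'n \<Rightarrow> real) \<Rightarrow> (real^'n \<Rightarrow> real) \<Rightarrow> bool" where
  "pos_solution \<alpha> p q u v \<longleftrightarrow>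
     u \<in> borel_measurable lborel \<and> v \<in> borel_measurable lborel \<and>
     (\<forall>x. u x > 0) \<and> (\<forall>x. v x > 0) \<and>
     (\<forall>x. integrable lborel (\<lambda>y. v y powr q / norm (x - y) powr (real CARD('n) - \<alpha>)) \<and>
          u x = riesz_pot \<alpha> (\<lambda>y. v y powr q) x) \<and>
     (\<forall>x. integrable lborel (\<lambda>y. u y powr p / norm (x - y) powr (real CARD('n) - \<alpha>)) \<and>
          v x = riesz_pot \<alpha> (\<lambda>y. u y powr p) x)"

definition asym_equiv :: "('a::real_normed_vector \<Rightarrow> real) \<Rightarrow> ('a \<Rightarrow> real) \<Rightarrow> bool" where
  "asym_equiv f g \<longleftrightarrow> (\<exists>C>0. \<exists>R. \<forall>x. norm x \<ge> R \<longrightarrow> g x / C \<le> f x \<and> f x \<le> C * g x)"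

end

theory Submission
  imports Defs
begin

text \<open>
  With \<open>\<beta> = N - \<alpha>\<close>, comparing the growth of a Riesz potential with that of its density shows that \<open>\<theta>1\<close> is
  either \<open>q * \<theta>2 - \<alpha>\<close> (when \<open>q * \<theta>2 < N\<close>) or \<open>\<beta>\<close> (when \<open>q * \<theta>2 > N\<close>), and symmetrically for \<open>\<theta>2\<close>; at
  \<open>q * \<theta>2 = N\<close> a logarithm would contradict the assumed power behaviour. This reduces everything to a
  Pohozaev identity: if \<open>u powr (p + 1)\<close> and \<open>v powr (q + 1)\<close> are integrable, the exponents are critical.

  The identity comes from the correlations \<open>F l = \<integral> u(l x)^p u(x) dx\<close> and \<open>G l = \<integral> v(l x) v(x)^q dx\<close>. Scaling
  and the symmetry of the kernel give \<open>G l = l^\<alpha> F l\<close>, and comparing derivatives at \<open>l = 1\<close> gives the claim.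
  No smoothness of \<open>u\<close> and \<open>v\<close> is used: it suffices that they are Hoelder continuous along dilations with an
  exponent above \<open>1/2\<close>, relative to their own size. Each application of the potential improves such an
  exponent \<open>\<gamma>\<close> to \<open>(\<gamma> + \<alpha>) / (1 + \<alpha>)\<close>, so iterating from \<open>\<gamma> = 0\<close> reaches every exponent below \<open>1\<close>.
\<close>

section \<open>Powers of the norm in Euclidean space\<close>

lemma has_bochner_integral_lborel_affine:
  fixes f :: "'a::euclidean_space \<Rightarrow> real"
  assumes "has_bochner_integral lborel f I" "c > 0"
  shows "has_bochner_integral lborel (\<lambda>x. f (t + c *\<^sub>R x)) (I / c ^ DIM('a))"
proof -
  have [measurable]: "f \<in> borel_measurable borel"
    using borel_measurable_has_bochner_integral[OF assms(1)] by simp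
  have eq: "lborel = density (distr lborel borel (\<lambda>x::'a. t + c *\<^sub>R x)) (\<lambda>_. ennreal (c ^ DIM('a)))"
    using lborel_affine[of c t] assms(2) by (simp add: ennreal_power)
  have 1: "integrable (density (distr lborel borel (\<lambda>x. t + c *\<^sub>R x)) (\<lambda>_. ennreal (c ^ DIM('a)))) f"
    using assms(1) eq by (simp add: has_bochner_integral_iff)
  have 2: "integral\<^sup>L (density (distr lborel borel (\<lambda>x. t + c *\<^sub>R x)) (\<lambda>_. ennreal (c ^ DIM('a)))) f = I"
    using assms(1) eq by (simp add: has_bochner_integral_iff)
  have "integrable lborel (\<lambda>x. f (t + c *\<^sub>R x))"
    using 1 assms(2) by (subst (asm) integrable_density) (auto simp: integrable_distr_eq)
  moreover have "I = c ^ DIM('a) * integral\<^sup>L lborel (\<lambda>x. f (t + c *\<^sub>R x))"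
    using 2 assms(2) by (subst (asm) integral_density) (auto simp: integral_distr)
  ultimately show ?thesis using assms(2) by (auto simp: has_bochner_integral_iff)
qed

text \<open>Takes the place of polar coordinates: the volume of a ball is a multiple of
  \<open>r k ^ DIM('a)\<close>, so integrability of a radial power turns into convergence of a
  geometric series over dyadic balls. Summing over all balls overcounts, but every value is covered
  by a single term.\<close>

lemma integrable_if_dominated_by_balls:
  fixes h :: "'a::euclidean_space \<Rightarrow> real" and c r :: "nat \<Rightarrow> real"
  assumes [measurable]: "h \<in> borel_measurable borel"
    and h: "\<And>y. 0 \<le> h y" "\<And>y. h y \<noteq> 0 \<Longrightarrow> \<exists>k. norm y < r k \<and> h y \<le> c k"
    and cr: "\<And>k. 0 \<le> c k" "\<And>k. 0 \<le> r k"
    and summ: "summable (\<lambda>k. c k * r k ^ DIM('a))"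
  shows "integrable lborel h"
proof (rule integrableI_bounded)
  let ?V = "unit_ball_vol (real DIM('a))"
  have le: "ennreal (h y) \<le> (\<Sum>k. ennreal (c k) * indicator (ball 0 (r k)) y)" for y
  proof (cases "h y = 0")
    case False
    then obtain k where k: "norm y < r k" "h y \<le> c k" using h by blast
    then have "ennreal (h y) \<le> ennreal (c k) * indicator (ball 0 (r k)) y"
      by (simp add: ennreal_leI)
    also have "\<dots> \<le> (\<Sum>k. ennreal (c k) * indicator (ball 0 (r k)) y)"
      using sum_le_suminf[OF summableI, of "{k}" "\<lambda>k. ennreal (c k) * indicator (ball 0 (r k)) y"]
      by (simp only: sum.insert finite.emptyI finite.insertI empty_iff not_False_eq_True sum.empty
          add_0_right subset_UNIV zero_le simp_thms)
    finally show ?thesis .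
  qed simp
  have "(\<integral>\<^sup>+ y. ennreal (norm (h y)) \<partial>lborel)
      \<le> (\<integral>\<^sup>+ y. (\<Sum>k. ennreal (c k) * indicator (ball (0::'a) (r k)) y) \<partial>lborel)"
    using le h(1) by (intro nn_integral_mono) auto
  also have "\<dots> = (\<Sum>k. \<integral>\<^sup>+ y. ennreal (c k) * indicator (ball (0::'a) (r k)) y \<partial>lborel)"
    by (intro nn_integral_suminf borel_measurable_times_ennreal borel_measurable_indicator) auto
  also have "\<dots> = (\<Sum>k. ennreal (?V * (c k * r k ^ DIM('a))))"
    using cr by (intro suminf_cong) (subst nn_integral_cmult_indicator, simp_all add: emeasure_ball ennreal_mult'[symmetric] mult_ac)
  also have "\<dots> < \<infinity>"
    using summable_mult[OF summ, of ?V] cr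
    by (subst suminf_ennreal2) (auto intro!: mult_nonneg_nonneg)
  finally show "(\<integral>\<^sup>+ y. ennreal (norm (h y)) \<partial>lborel) < \<infinity>" .
qed simp

lemma power_powr_eq: "(a ^ m) powr x = (a powr x) ^ m" if "a > 0" for a x :: real
  using that by (induction m) (auto simp: powr_mult)

lemma integrable_norm_powr_unit_ball:
  fixes s :: real
  assumes "0 \<le> s" "s < DIM('a)"
  shows "integrable lborel (\<lambda>y::'a::euclidean_space. indicator (ball 0 1) y * norm y powr (- s))"
\<comment> \<open>The shells are \<open>(1/2) ^ Suc k < norm y \<le> (1/2) ^ k\<close>. The factor 2
  in the radius puts their closed outer boundary inside an open ball.\<close>
proof (rule integrable_if_dominated_by_balls[where
      r = "\<lambda>k. 2 * (1/2) ^ k" and c = "\<lambda>k. ((1/2) ^ Suc k) powr (- s)"])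
  fix y :: 'a
  assume "indicator (ball 0 1) y * norm y powr (- s) \<noteq> 0"
  then have y: "0 < norm y" "norm y < 1" by (auto simp: indicator_def split: if_splits)
  obtain m where "(1/2) ^ m < norm y"
    using real_arch_pow_inv[of "norm y" "1/2"] y by auto
  then have "\<exists>k<m. (\<forall>i\<le>k. \<not> (1/2) ^ i < norm y) \<and> (1/2) ^ Suc k < norm y"
    using y by (intro ex_least_nat_less) auto
  then obtain j where j: "norm y \<le> (1/2) ^ j" "(1/2) ^ Suc j < norm y"
    by (meson linorder_not_less order_refl)
  then have "norm y < 2 * (1/2) ^ j" using y by simp
  moreover have "indicator (ball 0 1) y * norm y powr (- s) \<le> ((1/2) ^ Suc j) powr (- s)"
    using j y assms by (simp del: power_Suc, intro powr_mono2') auto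
  ultimately show "\<exists>j. norm y < 2 * (1/2) ^ j \<and>
      indicator (ball 0 1) y * norm y powr (- s) \<le> ((1/2) ^ Suc j) powr (- s)" by blast
next
  have 1: "((1/2) ^ Suc k) powr (- s) * (2 * (1/2) ^ k) ^ DIM('a)
      = 2 ^ DIM('a) * (1/2) powr (- s) * ((1/2) powr (- s) * (1/2) ^ DIM('a)) ^ k" for k :: nat
    by (subst power_powr_eq) (simp_all add: power_mult_distrib power_mult[symmetric] mult_ac)
  have 2: "(1/2) powr (- s) * (1/2) ^ DIM('a) = (1/2::real) powr (DIM('a) - s)"
    by (simp add: powr_realpow[symmetric] powr_add[symmetric])
  have 3: "(1/2::real) powr (DIM('a) - s) < 1" using assms by (simp add: powr01_less_one)
  show "summable (\<lambda>k. ((1/2) ^ Suc k) powr (- s) * (2 * (1/2) ^ k) ^ DIM('a))"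
    unfolding 1 2 using 3 by (intro summable_mult summable_geometric) simp
qed (auto intro!: borel_measurable_times borel_measurable_indicator borel_comp)

lemma integrable_norm_powr_outside_unit_ball:
  fixes s :: real
  assumes "s > DIM('a)"
  shows "integrable lborel (\<lambda>y::'a::euclidean_space. indicator (- ball 0 1) y * norm y powr (- s))"
proof (rule integrable_if_dominated_by_balls[where
      r = "\<lambda>k. 2 ^ Suc k" and c = "\<lambda>k. (2 ^ k) powr (- s)"])
  fix y :: 'a
  assume "indicator (- ball 0 1) y * norm y powr (- s) \<noteq> 0"
  then have y: "1 \<le> norm y" by (auto simp: indicator_def split: if_splits)
  obtain m where "norm y < 2 ^ m"
    using real_arch_pow[of 2 "norm y"] y by auto
  then have "\<exists>k<m. (\<forall>i\<le>k. \<not> norm y < 2 ^ i) \<and> norm y < 2 ^ Suc k"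
    using y by (intro ex_least_nat_less) auto
  then obtain j where j: "2 ^ j \<le> norm y" "norm y < 2 ^ Suc j"
    by (meson linorder_not_less order_refl)
  then have "indicator (- ball 0 1) y * norm y powr (- s) \<le> (2 ^ j) powr (- s)"
    using assms y by (simp, intro powr_mono2') auto
  then show "\<exists>j. norm y < 2 ^ Suc j \<and>
      indicator (- ball 0 1) y * norm y powr (- s) \<le> (2 ^ j) powr (- s)" using j by blast
next
  have 1: "(2 ^ k) powr (- s) * (2 ^ Suc k) ^ DIM('a)
      = 2 ^ DIM('a) * (2 powr (- s) * 2 ^ DIM('a)) ^ k" for k :: nat
    by (subst power_powr_eq) (simp_all add: power_mult_distrib power_mult[symmetric] mult_ac)
  have 2: "2 powr (- s) * 2 ^ DIM('a) = (2::real) powr (DIM('a) - s)"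
    by (simp add: powr_realpow[symmetric] powr_add[symmetric])
  have 3: "(2::real) powr (DIM('a) - s) < 1" using assms by (intro powr_less_one) auto
  show "summable (\<lambda>k. (2 ^ k) powr (- s) * (2 ^ Suc k) ^ DIM('a))"
    unfolding 1 2 using 3 by (intro summable_mult summable_geometric) simp
qed (auto intro!: borel_measurable_times borel_measurable_indicator borel_comp)

lemma integrable_one_plus_norm_powr:
  fixes s :: real
  assumes "s > DIM('a)"
  shows "integrable lborel (\<lambda>y::'a::euclidean_space. (1 + norm y) powr (- s))"
proof -
  have "integrable lborel (\<lambda>y::'a. indicator (ball 0 1) y + indicator (- ball 0 1) y * norm y powr (- s))"
    using assms by (intro Bochner_Integration.integrable_add integrable_norm_powr_outside_unit_ball)
      (auto simp: emeasure_ball intro!: integrable_real_indicator)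
  then show ?thesis
  proof (rule Bochner_Integration.integrable_bound)
    have *: "(1 + norm y) powr (- s) \<le> indicator (ball 0 1) y + indicator (- ball 0 1) y * norm y powr (- s)" for y :: 'a
    proof (cases "norm y < 1")
      case True
      have "(1 + norm y) powr (- s) \<le> 1 powr (-s)" using assms by (intro powr_mono2') auto
      then show ?thesis using True by simp
    next
      case False
      then have "(1 + norm y) powr (- s) \<le> norm y powr (-s)" using assms by (intro powr_mono2') auto
      then show ?thesis using False by simp
    qed
    then show "AE y in lborel. norm ((1 + norm (y::'a)) powr (- s))
        \<le> norm (indicator (ball 0 1) y + indicator (- ball 0 1) y * norm y powr (- s))"
      unfolding real_norm_def abs_of_nonneg[OF powr_ge_zero]
      by (intro always_eventually allI order_trans[OF * abs_ge_self])
  next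
    show "(\<lambda>y::'a. (1 + norm y) powr (- s)) \<in> borel_measurable lborel" by measurable
  qed
qed

text \<open>The measure \<open>norm y powr - DIM('a) dy\<close> is dilation invariant, so a finite total mass
  outside a ball would force the shells to have mass zero.\<close>
lemma not_integrable_one_plus_norm_powr:
  "\<not> integrable lborel (\<lambda>y::'a::euclidean_space. (1 + norm y) powr (- real DIM('a)))"
proof
  let ?n = "real DIM('a)"
  assume int: "integrable lborel (\<lambda>y::'a. (1 + norm y) powr (- ?n))"
  define h where "h = (\<lambda>y::'a. indicator (- ball 0 1) y * norm y powr (- ?n))"
  have "integrable lborel h"
  proof (rule Bochner_Integration.integrable_bound[OF integrable_mult_right[OF int, of "2 powr ?n"]])
    have "h y \<le> 2 powr ?n * (1 + norm y) powr (- ?n)" for y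
    proof (cases "norm y < 1")
      case False
      then have "(2 * norm y) powr (- ?n) \<le> (1 + norm y) powr (- ?n)"
        by (intro powr_mono2') auto
      then show ?thesis using False
        by (simp add: h_def powr_mult powr_minus[of 2] divide_simps mult.commute)
    qed (auto simp: h_def)
    moreover have "h y \<ge> 0" for y by (simp add: h_def)
    ultimately show "AE y in lborel. norm (h y) \<le> norm (2 powr ?n * (1 + norm y) powr (- ?n))" by auto
  next
    show "h \<in> borel_measurable lborel" unfolding h_def
      by (auto intro!: borel_measurable_times borel_measurable_indicator borel_comp)
  qed
  then have hI: "has_bochner_integral lborel h (integral\<^sup>L lborel h)" by (simp add: has_bochner_integral_iff)
  have "has_bochner_integral lborel (\<lambda>x. h (0 + 2 *\<^sub>R x)) (integral\<^sup>L lborel h / 2 ^ DIM('a))"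
    by (rule has_bochner_integral_lborel_affine[OF hI]) simp
  then have "has_bochner_integral lborel (\<lambda>x. 2 ^ DIM('a) * h (0 + 2 *\<^sub>R x)) (2 ^ DIM('a) * (integral\<^sup>L lborel h / 2 ^ DIM('a)))"
    by (rule has_bochner_integral_mult_right)
  then have "has_bochner_integral lborel (\<lambda>x. 2 ^ DIM('a) * h (0 + 2 *\<^sub>R x) - h x) 0"
    using has_bochner_integral_diff[OF _ hI, of "\<lambda>x. 2 ^ DIM('a) * h (0 + 2 *\<^sub>R x)"] by fastforce
  moreover have "2 ^ DIM('a) * h (0 + 2 *\<^sub>R x) - h x = indicator (ball 0 1 - ball 0 (1/2)) x * norm x powr (- ?n)" for x
    by (auto simp: h_def indicator_def powr_mult powr_minus powr_realpow)
  ultimately have 0: "has_bochner_integral lborel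
      (\<lambda>x::'a. indicator (ball 0 1 - ball 0 (1/2)) x * norm x powr (- ?n)) 0" by simp
  then have "AE x in lborel. indicator (ball 0 1 - ball 0 (1/2)) (x::'a) * norm x powr (- ?n) = 0"
    by (subst integral_nonneg_eq_0_iff_AE[symmetric]) (auto simp: has_bochner_integral_iff)
  \<comment> \<open>Removing the closed inner ball leaves an open shell, and an open null set is
    empty.\<close>
  then have "AE x in lborel. x \<notin> ball 0 1 - cball (0::'a) (1/2)"
    by eventually_elim (auto simp: indicator_def split: if_splits)
  moreover have "open (ball 0 1 - cball (0::'a) (1/2))" by auto
  ultimately have "ball 0 1 - cball (0::'a) (1/2) = {}"
    using AE_iff_null_sets[of "ball 0 1 - cball (0::'a) (1/2)" lborel] open_not_negligible
      null_sets_completionI negligible_iff_null_sets by (metis borel_open sets_lborel)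
  moreover obtain b :: 'a where "b \<in> Basis" using nonempty_Basis by blast
  then have "(3/4) *\<^sub>R b \<in> ball 0 1 - cball 0 (1/2)" by simp
  ultimately show False by blast
qed

text \<open>Mean value theorem on a compact interval away from 0, where the derivative is bounded
  whatever the sign of \<open>p\<close>. It is applied to ratios of values at
  \<open>l *\<^sub>R x\<close> and \<open>x\<close>, to ratios of truncated distances (with the
  exponent \<open>- \<beta>\<close>), and to \<open>l\<close> itself.\<close>

lemma powr_lipschitz_at_1:
  fixes a b p :: real
  assumes "0 < a" "a \<le> 1" "1 \<le> b"
  obtains L where "L > 0" "\<And>z. a \<le> z \<Longrightarrow> z \<le> b \<Longrightarrow> \<bar>z powr p - 1\<bar> \<le> L * \<bar>z - 1\<bar>"
proof -
  have "bounded ((\<lambda>z. p * z powr (p - 1)) ` {a..b})"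
    using assms by (intro compact_imp_bounded compact_continuous_image continuous_intros) auto
  then obtain L where L: "L > 0" "\<And>z. z \<in> {a..b} \<Longrightarrow> \<bar>p * z powr (p - 1)\<bar> \<le> L"
    by (auto simp: bounded_pos)
  have "norm (z powr p - 1 powr p) \<le> L * norm (z - 1)" if "a \<le> z" "z \<le> b" for z
  proof (rule field_differentiable_bound[where S = "{a..b}" and f' = "\<lambda>z. p * z powr (p - 1)"])
    show "((\<lambda>z. z powr p) has_field_derivative p * z powr (p - 1)) (at z within {a..b})" if "z \<in> {a..b}" for z
      using that assms by (auto intro!: derivative_eq_intros simp: powr_diff)
  qed (use L assms that in auto)
  then show ?thesis using that L by auto
qed

lemma has_bochner_integral_mono_AE:
  fixes f g :: "'a \<Rightarrow> real"
  assumes "has_bochner_integral M f a" "has_bochner_integral M g b" "AE x in M. f x \<le> g x"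
  shows "a \<le> b"
  using assms integral_mono_AE[of M f g] by (auto simp: has_bochner_integral_iff)

section \<open>Power decay and regularity along dilations\<close>

text \<open>The bounds hold at every point and not only near infinity; \<open>1 + norm x\<close>
  removes the singularity at the origin. One pair of constants then serves for pointwise comparisons
  and for integrals over the whole space.\<close>

definition power_decay :: "real \<Rightarrow> ('a::euclidean_space \<Rightarrow> real) \<Rightarrow> bool" where
  "power_decay \<theta> v \<longleftrightarrow> (\<exists>c>0. \<exists>C>0. \<forall>x. c * (1 + norm x) powr (- \<theta>) \<le> v x \<and> v x \<le> C * (1 + norm x) powr (- \<theta>))"

text \<open>A Hoelder condition in the direction of dilations, relative to the size of
  \<open>v\<close>. Being relative, it passes to powers of \<open>v\<close> and can be integrated
  against a positive weight. Dilations with \<open>l \<ge> 1\<close> are enough, since only right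
  difference quotients at 1 are taken.\<close>

definition dilation_regular :: "real \<Rightarrow> ('a::euclidean_space \<Rightarrow> real) \<Rightarrow> bool" where
  "dilation_regular \<gamma> v \<longleftrightarrow>
     (\<exists>C>0. \<forall>x. \<forall>l\<in>{1..2}. \<bar>v (l *\<^sub>R x) - v x\<bar> \<le> C * (l - 1) powr \<gamma> * v x)"

lemma power_decay_powr:
  assumes "power_decay \<theta> v" "q > 0"
  shows "power_decay (q * \<theta>) (\<lambda>x. v x powr q)"
proof -
  obtain c C where c: "c > 0" "C > 0"
    and b: "\<And>x. c * (1 + norm x) powr (- \<theta>) \<le> v x" "\<And>x. v x \<le> C * (1 + norm x) powr (- \<theta>)"
    using assms(1) unfolding power_decay_def by blast
  have v: "0 \<le> v x" for x
    using b(1)[of x] c(1) by (meson mult_nonneg_nonneg order.trans less_imp_le powr_ge_zero)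
  have e: "(r * (1 + norm x) powr (- \<theta>)) powr q = r powr q * (1 + norm x) powr (- (q * \<theta>))" if "r > 0" for r and x :: 'a
    using that by (simp add: powr_mult powr_powr mult.commute)
  have "c powr q * (1 + norm x) powr (- (q * \<theta>)) \<le> v x powr q" for x
    unfolding e[OF c(1), symmetric] using b(1)[of x] c assms(2) by (intro powr_mono2) auto
  moreover have "v x powr q \<le> C powr q * (1 + norm x) powr (- (q * \<theta>))" for x
    unfolding e[OF c(2), symmetric] using b(2)[of x] v assms(2) by (intro powr_mono2) auto
  ultimately show ?thesis unfolding power_decay_def
    using c by (intro exI[of _ "c powr q"] exI[of _ "C powr q"] conjI allI) auto
qed

text \<open>A Harnack inequality. It is one-sided: moving \<open>y\<close> towards the origin only
  raises the decay profile, so only an upper bound on \<open>norm y\<close> enters, and it amounts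
  to \<open>1 + norm y \<le> 2 * (1 + norm x)\<close>.\<close>

lemma power_decay_ratio:
  fixes v :: "'a::euclidean_space \<Rightarrow> real"
  assumes "power_decay \<theta> v" "\<theta> \<ge> 0"
  obtains B where "B \<ge> 1"
    "\<And>x y. norm y \<le> 1 + 2 * norm x \<Longrightarrow> v x \<le> B * v y"
proof -
  obtain c C where c: "c > 0" "C > 0"
    and b: "\<And>x. c * (1 + norm x) powr (- \<theta>) \<le> v x" "\<And>x. v x \<le> C * (1 + norm x) powr (- \<theta>)"
    using assms(1) unfolding power_decay_def by blast
  define B where "B = C / c * 2 powr \<theta>"
  have le: "v x \<le> B * v y" if "norm y \<le> 1 + 2 * norm x" for x y
  proof -
    have "v x \<le> C * (1 + norm x) powr (- \<theta>)" by (rule b)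
    also have "(1 + norm x) powr (- \<theta>) = 2 powr \<theta> * (2 * (1 + norm x)) powr (- \<theta>)"
      by (simp add: powr_mult powr_minus del: distrib_left_numeral)
    also have "\<dots> \<le> 2 powr \<theta> * (1 + norm y) powr (- \<theta>)"
      using that assms(2) by (intro mult_left_mono powr_mono2') (auto intro: add_pos_nonneg)
    also have "\<dots> \<le> 2 powr \<theta> * (v y / c)"
      using b(1)[of y] c by (intro mult_left_mono) (auto simp: field_simps)
    finally show ?thesis using c by (simp add: B_def field_simps)
  qed
  have "v 0 > 0" using b(1)[of 0] c by simp
  then have "B \<ge> 1" using le[of 0 0] by simp
  then show ?thesis using le that by blast
qed

lemma power_decay_pos:
  assumes "power_decay \<theta> v"
  shows "v x > 0"
proof -
  obtain c where c: "c > 0" "c * (1 + norm x) powr (- \<theta>) \<le> v x"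
    using assms unfolding power_decay_def by blast
  have "1 + norm x \<noteq> 0" using norm_ge_zero[of x] by linarith
  then have "0 < c * (1 + norm x) powr (- \<theta>)" using c(1) by (intro mult_pos_pos) auto
  then show ?thesis using c(2) by linarith
qed

lemma dilation_bounds:
  fixes v :: "'a::euclidean_space \<Rightarrow> real"
  assumes "power_decay \<theta> v" "\<theta> \<ge> 0"
  obtains B where "B \<ge> 1"
    "\<And>x l. l \<in> {1..2} \<Longrightarrow> v (l *\<^sub>R x) / v x \<in> {1 / B..B}"
proof -
  obtain B where B: "B \<ge> 1" "\<And>x y. norm y \<le> 1 + 2 * norm x \<Longrightarrow> v x \<le> B * v y"
    by (rule power_decay_ratio[OF assms]) blast
  have "v (l *\<^sub>R x) / v x \<in> {1 / B..B}" if l: "l \<in> {1..2}" for x l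
  proof -
    have "l * norm x \<le> 2 * norm x" "norm x \<le> l * norm x"
      using l mult_right_mono[of 1 l "norm x"] by (auto intro: mult_right_mono)
    then have "v x \<le> B * v (l *\<^sub>R x)" "v (l *\<^sub>R x) \<le> B * v x"
      using l by (auto intro!: B(2))
    then show ?thesis
      using B(1) power_decay_pos[OF assms(1), of x] by (auto simp: field_simps)
  qed
  then show ?thesis using B(1) that by blast
qed

lemma dilation_regular_0:
  assumes "power_decay \<theta> v" "\<theta> \<ge> 0"
  shows "dilation_regular 0 v"
proof -
  obtain B where B: "B \<ge> 1" "\<And>x l. l \<in> {1..2} \<Longrightarrow> v (l *\<^sub>R x) / v x \<in> {1 / B..B}"
    by (rule dilation_bounds[OF assms]) blast
  have "\<bar>v (l *\<^sub>R x) - v x\<bar> \<le> B * (l - 1) powr 0 * v x" if l: "l \<in> {1..2}" for x l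
  \<comment> \<open>Since \<open>0 powr 0 = 0\<close>, the right side vanishes at
    \<open>l = 1\<close> even for exponent 0; elsewhere \<open>(l - 1) powr 0 = 1\<close>.\<close>
  proof (cases "l = 1")
    case False
    have v: "v x > 0" "v (l *\<^sub>R x) > 0" using power_decay_pos[OF assms(1)] by auto
    have "v (l *\<^sub>R x) \<le> B * v x" using B(2)[OF l, of x] v by (auto simp: field_simps)
    moreover have "v x \<le> B * v x" using B(1) v by simp
    ultimately have "\<bar>v (l *\<^sub>R x) - v x\<bar> \<le> B * v x" using v by linarith
    then show ?thesis using False by simp
  qed simp
  then show ?thesis unfolding dilation_regular_def using B(1) by (intro exI[of _ B]) auto
qed

text \<open>The ratio \<open>v (l *\<^sub>R x) / v x\<close> stays in a compact interval of positive
  numbers, on which every power is Lipschitz. Hence the exponent \<open>\<gamma>\<close> is not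
  diminished, even when \<open>q < 1\<close>.\<close>

lemma dilation_regular_powr:
  assumes "power_decay \<theta> v" "\<theta> \<ge> 0" "dilation_regular \<gamma> v"
  shows "dilation_regular \<gamma> (\<lambda>x. v x powr q)"
proof -
  obtain B where B: "B \<ge> 1" "\<And>x l. l \<in> {1..2} \<Longrightarrow> v (l *\<^sub>R x) / v x \<in> {1 / B..B}"
    by (rule dilation_bounds[OF assms(1,2)]) blast
  obtain L where L: "L > 0" "\<And>z. 1 / B \<le> z \<Longrightarrow> z \<le> B \<Longrightarrow> \<bar>z powr q - 1\<bar> \<le> L * \<bar>z - 1\<bar>"
    using powr_lipschitz_at_1[of "1 / B" B q] B(1) by auto
  obtain C where C: "C > 0" "\<And>x l. l \<in> {1..2} \<Longrightarrow> \<bar>v (l *\<^sub>R x) - v x\<bar> \<le> C * (l - 1) powr \<gamma> * v x"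
    using assms(3) unfolding dilation_regular_def by blast
  have "\<bar>v (l *\<^sub>R x) powr q - v x powr q\<bar> \<le> (L * C) * (l - 1) powr \<gamma> * v x powr q"
    if l: "l \<in> {1..2}" for x l
  proof -
    have v: "v x > 0" "v (l *\<^sub>R x) > 0" using power_decay_pos[OF assms(1)] by auto
    define z where "z = v (l *\<^sub>R x) / v x"
    have z: "v (l *\<^sub>R x) = z * v x" "z > 0" using v by (auto simp: z_def)
    have "\<bar>z - 1\<bar> * v x = \<bar>v (l *\<^sub>R x) - v x\<bar>" using v by (simp add: abs_mult_pos[OF less_imp_le, of "v x"] z(1) left_diff_distrib)
    also have "\<dots> \<le> C * (l - 1) powr \<gamma> * v x" by (rule C(2)[OF l])
    finally have "\<bar>z - 1\<bar> \<le> C * (l - 1) powr \<gamma>" using v by simp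
    moreover have "\<bar>z powr q - 1\<bar> \<le> L * \<bar>z - 1\<bar>" using B(2)[OF l, of x] by (intro L(2)) (auto simp: z_def)
    ultimately have "\<bar>z powr q - 1\<bar> \<le> L * C * (l - 1) powr \<gamma>"
      using mult_left_mono[of "\<bar>z - 1\<bar>" "C * (l - 1) powr \<gamma>" L] less_imp_le[OF L(1)]
      unfolding mult.assoc by (meson order_trans)
    then have "\<bar>z powr q - 1\<bar> * v x powr q \<le> L * C * (l - 1) powr \<gamma> * v x powr q"
      by (intro mult_right_mono) auto
    also have "\<bar>z powr q - 1\<bar> * v x powr q = \<bar>(z powr q - 1) * v x powr q\<bar>" by (simp add: abs_mult)
    also have "(z powr q - 1) * v x powr q = v (l *\<^sub>R x) powr q - v x powr q"
      using v z by (simp add: powr_mult left_diff_distrib)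
    finally show ?thesis .
  qed
  then show ?thesis unfolding dilation_regular_def using L(1) C(1) by (intro exI[of _ "L * C"]) auto
qed

lemma has_bochner_integral_lborel_pos:
  fixes g :: "'a::euclidean_space \<Rightarrow> real"
  assumes "has_bochner_integral lborel g I" "\<And>x. g x \<ge> 0" "\<And>x. x \<in> S \<Longrightarrow> g x > 0" "open S" "S \<noteq> {}"
  shows "I > 0"
proof (rule ccontr)
  assume "\<not> I > 0"
  moreover have "I \<ge> 0"
    using has_bochner_integral_mono_AE[OF has_bochner_integral_zero assms(1)] assms(2) by auto
  ultimately have "I = 0" by simp
  then have "AE x in lborel. g x = 0"
    using assms(1,2) by (subst integral_nonneg_eq_0_iff_AE[symmetric]) (auto simp: has_bochner_integral_iff)
  then have "AE x in lborel. x \<notin> S"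
    by eventually_elim (use assms(3) in force)
  then have "S \<in> null_sets lborel"
    using AE_iff_null_sets[of S lborel] assms(4) by auto
  then show False
    using assms(4,5) open_not_negligible null_sets_completionI negligible_iff_null_sets by metis
qed

section \<open>Riesz potentials\<close>

text \<open>Dilation changes either argument of the maximum by at most
  \<open>(l - 1) * norm x\<close>, while both maxima are at least \<open>d * norm x\<close>. The
  relative change is thus at most \<open>(l - 1) / d\<close>, and \<open>l - 1 \<le> 2 * d\<close>
  bounds this by 2, whence the fixed interval from 1/3 to 3.\<close>

lemma truncation_diff:
  fixes x y :: "'a::real_normed_vector"
  assumes "0 < d" "d \<le> 1/2" "1 \<le> l" "l \<le> 2" "l - 1 \<le> 2 * d" "x \<noteq> 0"
  shows "max (norm (l *\<^sub>R x - y)) (d * norm (l *\<^sub>R x)) / max (norm (x - y)) (d * norm x) \<in> {1/3..3}"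
    and "\<bar>max (norm (l *\<^sub>R x - y)) (d * norm (l *\<^sub>R x)) / max (norm (x - y)) (d * norm x) - 1\<bar> \<le> (l - 1) / d"
proof -
  define m where "m = max (norm (x - y)) (d * norm x)"
  define m' where "m' = max (norm (l *\<^sub>R x - y)) (d * norm (l *\<^sub>R x))"
  have r: "norm x > 0" using assms by simp
  have "norm ((l *\<^sub>R x - y) - (x - y)) = norm ((l - 1) *\<^sub>R x)" by (simp add: algebra_simps)
  then have "norm ((l *\<^sub>R x - y) - (x - y)) = (l - 1) * norm x" using assms by simp
  then have "\<bar>norm (l *\<^sub>R x - y) - norm (x - y)\<bar> \<le> (l - 1) * norm x"
    using norm_triangle_ineq3[of "l *\<^sub>R x - y" "x - y"] by simp
  moreover have "\<bar>d * norm (l *\<^sub>R x) - d * norm x\<bar> \<le> (l - 1) * norm x"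
  proof -
    have "d * norm (l *\<^sub>R x) - d * norm x = d * ((l - 1) * norm x)" using assms by (simp add: algebra_simps)
    moreover have "0 \<le> (l - 1) * norm x" using assms by simp
    moreover have "d * ((l - 1) * norm x) \<le> 1 * ((l - 1) * norm x)" using assms by (intro mult_right_mono) auto
    ultimately show ?thesis using assms by simp
  qed
  ultimately have diff: "\<bar>m' - m\<bar> \<le> (l - 1) * norm x" unfolding m_def m'_def by linarith
  have m: "d * norm x \<le> m" "d * norm x \<le> m'"
    using assms r mult_left_mono[of "norm x" "l * norm x" d] by (auto simp: m_def m'_def le_max_iff_disj)
  have mp: "m > 0" "m' > 0" using m mult_pos_pos[OF assms(1) r] by linarith+
  have e: "(l - 1) * norm x = (l - 1) / d * (d * norm x)" using assms by simp
  have e0: "0 \<le> (l - 1) / d" "(l - 1) / d \<le> 2" using assms by (auto simp: field_simps)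
  have 1: "(l - 1) * norm x \<le> (l - 1) / d * m" unfolding e using m e0 by (intro mult_left_mono) auto
  have 2: "(l - 1) * norm x \<le> (l - 1) / d * m'" unfolding e using m e0 by (intro mult_left_mono) auto
  have 3: "(l - 1) / d * m \<le> 2 * m" "(l - 1) / d * m' \<le> 2 * m'" 
    using mult_right_mono[OF e0(2)] mp by (auto simp: less_imp_le)
  have "m' / m \<in> {1/3..3}"
    using diff 1 2 3 mp by (auto simp: field_simps abs_le_iff)
  then show "max (norm (l *\<^sub>R x - y)) (d * norm (l *\<^sub>R x)) / max (norm (x - y)) (d * norm x) \<in> {1/3..3}"
    by (simp add: m_def m'_def)
  have "\<bar>m' / m - 1\<bar> = \<bar>m' - m\<bar> / m" using mp by (simp add: field_simps abs_if)
  also have "\<dots> \<le> (l - 1) / d" using diff 1 mp by (simp add: divide_le_eq)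
  finally show "\<bar>max (norm (l *\<^sub>R x - y)) (d * norm (l *\<^sub>R x)) / max (norm (x - y)) (d * norm x) - 1\<bar> \<le> (l - 1) / d"
    by (simp add: m_def m'_def)
qed

text \<open>\<open>\<beta>\<close> is the exponent of the kernel, so the order of the potential is
  \<open>DIM('a) - \<beta>\<close>. Using \<open>has_bochner_integral\<close> records finiteness
  together with the value. At \<open>y = x\<close> the kernel has the default value 0 instead of
  infinity, so lower bounds for it are available only for almost every \<open>y\<close>.\<close>

locale riesz =
  fixes \<beta> :: real and f u :: "'a::euclidean_space \<Rightarrow> real"
  assumes beta: "0 < \<beta>" "\<beta> < DIM('a)"
    and f_measurable[measurable]: "f \<in> borel_measurable borel"
    and f_pos: "\<And>y. f y > 0"
    and potential: "\<And>x. has_bochner_integral lborel (\<lambda>y. f y * norm (x - y) powr (- \<beta>)) (u x)"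
begin

section \<open>Mass of the kernel on balls, positivity of potentials\<close>

definition ball_mass :: real where
  "ball_mass = (LINT z|lborel. indicator (ball (0::'a) 1) z * norm z powr (- \<beta>))"

lemma ball_mass_pos: "ball_mass > 0"
proof (rule has_bochner_integral_lborel_pos)
  show "has_bochner_integral lborel (\<lambda>z::'a. indicator (ball 0 1) z * norm z powr (- \<beta>)) ball_mass"
    using integrable_norm_powr_unit_ball[of \<beta>, where 'a = 'a] beta
    by (simp add: has_bochner_integral_iff ball_mass_def)
  show "open (ball (0::'a) 1 - {0})" by (intro open_Diff) auto
  obtain b :: 'a where "b \<in> Basis" using nonempty_Basis by blast
  then have "(1/2) *\<^sub>R b \<in> ball 0 1 - {0}" by auto
  then show "ball (0::'a) 1 - {0} \<noteq> {}" by blast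
qed auto

lemma kernel_ball:
  assumes "r > 0"
  shows "has_bochner_integral lborel (\<lambda>y::'a. indicator (ball x r) y * norm (x - y) powr (- \<beta>))
    (ball_mass * r powr (DIM('a) - \<beta>))"
proof -
  have "has_bochner_integral lborel (\<lambda>z::'a. indicator (ball 0 1) z * norm z powr (- \<beta>)) ball_mass"
    using integrable_norm_powr_unit_ball[of \<beta>, where 'a = 'a] beta
    by (simp add: has_bochner_integral_iff ball_mass_def)
  from has_bochner_integral_lborel_affine[OF this, of "1/r" "- (1/r) *\<^sub>R x"] assms
  have "has_bochner_integral lborel (\<lambda>y::'a. indicator (ball 0 1) (- (1/r) *\<^sub>R x + (1/r) *\<^sub>R y)
      * norm (- (1/r) *\<^sub>R x + (1/r) *\<^sub>R y) powr (- \<beta>)) (ball_mass / (1/r) ^ DIM('a))"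
    by simp
  from has_bochner_integral_mult_right[OF this, of "r powr (- \<beta>)"]
  have I: "has_bochner_integral lborel (\<lambda>y::'a. r powr (- \<beta>) * (indicator (ball 0 1) (- (1/r) *\<^sub>R x + (1/r) *\<^sub>R y)
      * norm (- (1/r) *\<^sub>R x + (1/r) *\<^sub>R y) powr (- \<beta>))) (r powr (- \<beta>) * (ball_mass / (1/r) ^ DIM('a)))"
    by simp
  have n: "norm (- (1/r) *\<^sub>R x + (1/r) *\<^sub>R y) = norm (x - y) / r" for y
  proof -
    have "- (1/r) *\<^sub>R x + (1/r) *\<^sub>R y = (1/r) *\<^sub>R (y - x)" by (simp add: algebra_simps)
    then show ?thesis using assms by (simp add: norm_minus_commute)
  qed
  have "r powr (- \<beta>) * (indicator (ball 0 1) (- (1/r) *\<^sub>R x + (1/r) *\<^sub>R y)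
      * norm (- (1/r) *\<^sub>R x + (1/r) *\<^sub>R y) powr (- \<beta>)) = indicator (ball x r) y * norm (x - y) powr (- \<beta>)" for y
    using assms unfolding indicator_def mem_ball dist_0_norm n
    by (simp add: powr_divide dist_norm)
  moreover have "r powr (- \<beta>) * (ball_mass / (1/r) ^ DIM('a)) = ball_mass * r powr (DIM('a) - \<beta>)"
    using assms by (simp add: power_divide powr_diff powr_minus powr_realpow field_simps)
  ultimately show ?thesis using I by simp
qed

lemma potential_pos: "u x > 0"
proof (rule has_bochner_integral_lborel_pos[OF potential])
  show "open (- {x})" by auto
  obtain b :: 'a where "b \<in> Basis" using nonempty_Basis by blast
  then have "x + b \<noteq> x" by auto
  then show "- {x} \<noteq> {}" by blast
qed (auto simp: f_pos intro!: mult_nonneg_nonneg less_imp_le[OF f_pos])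

text \<open>The bound \<open>norm (x - y) \<le> (1 + norm x) * (1 + norm y)\<close> separates the
  variables in the kernel, and the remaining integral in \<open>y\<close> is a positive constant,
  finite by comparison with \<open>u 0\<close>. So a potential never decays faster than its
  kernel.\<close>

lemma potential_lower:
  obtains c where "c > 0" "\<And>x. c * (1 + norm x) powr (- \<beta>) \<le> u x"
proof -
  define I where "I = (LINT y|lborel. f y * (1 + norm y) powr (- \<beta>))"
  have AE: "AE y in lborel. y \<noteq> x" for x :: 'a by (rule AE_lborel_singleton)
  have le: "(1 + norm x) powr (- \<beta>) * (1 + norm y) powr (- \<beta>) \<le> norm (x - y) powr (- \<beta>)" if "y \<noteq> x" for x y :: 'a
  proof -
    have "norm (x - y) \<le> (1 + norm x) * (1 + norm y)"
      using norm_triangle_ineq4[of x y] mult_nonneg_nonneg[OF norm_ge_zero[of x] norm_ge_zero[of y]]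
      by (simp add: distrib_left distrib_right del: norm_ge_zero)
    then have "((1 + norm x) * (1 + norm y)) powr (- \<beta>) \<le> norm (x - y) powr (- \<beta>)"
      using that beta by (intro powr_mono2') auto
    then show ?thesis by (simp add: powr_mult)
  qed
  have int: "integrable lborel (\<lambda>y. f y * (1 + norm y) powr (- \<beta>))"
  proof (rule Bochner_Integration.integrable_bound)
    show "integrable lborel (\<lambda>y. f y * norm (0 - y) powr (- \<beta>))" 
      using potential[of 0] by (simp only: has_bochner_integral_iff)
    show "AE y in lborel. norm (f y * (1 + norm y) powr (- \<beta>)) \<le> norm (f y * norm (0 - y) powr (- \<beta>))"
      using AE[of 0] by eventually_elim (use le[of _ 0] f_pos less_imp_le in \<open>auto simp: abs_mult intro!: mult_left_mono\<close>)
  qed measurable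
  then have I: "has_bochner_integral lborel (\<lambda>y. f y * (1 + norm y) powr (- \<beta>)) I"
    by (simp add: has_bochner_integral_iff I_def)
  have "I > 0"
    by (rule has_bochner_integral_lborel_pos[OF I, of UNIV]) (auto simp: add_nonneg_eq_0_iff f_pos intro!: mult_nonneg_nonneg less_imp_le[OF f_pos])
  moreover have "I * (1 + norm x) powr (- \<beta>) \<le> u x" for x
  proof -
    have "has_bochner_integral lborel (\<lambda>y. f y * (1 + norm y) powr (- \<beta>) * (1 + norm x) powr (- \<beta>)) (I * (1 + norm x) powr (- \<beta>))"
      by (rule has_bochner_integral_mult_left) (use I in auto)
    then show ?thesis
    proof (rule has_bochner_integral_mono_AE[OF _ potential])
      show "AE y in lborel. f y * (1 + norm y) powr (- \<beta>) * (1 + norm x) powr (- \<beta>) \<le> f y * norm (x - y) powr (- \<beta>)"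
        using AE[of x]
      proof eventually_elim
        case (elim y)
        then have "f y * ((1 + norm x) powr (- \<beta>) * (1 + norm y) powr (- \<beta>)) \<le> f y * norm (x - y) powr (- \<beta>)"
          using le[of y x] less_imp_le[OF f_pos] by (intro mult_left_mono) auto
        then show ?case by (simp add: mult_ac)
      qed
    qed
  qed
  ultimately show ?thesis using that by blast
qed


text \<open>On the ball of radius \<open>norm x / 2\<close> about \<open>x\<close> the density is
  comparable to \<open>f x\<close>, and the kernel has mass proportional to
  \<open>norm x powr (DIM('a) - \<beta>)\<close> there.\<close>

lemma potential_ball_lower:
  assumes "power_decay a f" "a \<ge> 0"
  obtains c where "c > 0" "\<And>x. c * (f x * norm x powr (DIM('a) - \<beta>)) \<le> u x"
proof -
  obtain B where B: "B \<ge> 1" "\<And>x y. norm y \<le> 1 + 2 * norm x \<Longrightarrow> f x \<le> B * f y"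
    by (rule power_decay_ratio[OF assms]) blast
  define c where "c = ball_mass * (1/2) powr (DIM('a) - \<beta>) / B"
  have "c > 0" using ball_mass_pos B(1) by (simp add: c_def)
  moreover have "c * (f x * norm x powr (DIM('a) - \<beta>)) \<le> u x" for x
  proof (cases "x = 0")
    case True
    then show ?thesis using potential_pos[of x] by simp
  next
    case False
    then have r: "norm x / 2 > 0" by simp
    have "has_bochner_integral lborel (\<lambda>y. (f x / B) * (indicator (ball x (norm x / 2)) y * norm (x - y) powr (- \<beta>)))
        ((f x / B) * (ball_mass * (norm x / 2) powr (DIM('a) - \<beta>)))"
      by (rule has_bochner_integral_mult_right) (use kernel_ball[OF r] in auto)
    then have "(f x / B) * (ball_mass * (norm x / 2) powr (DIM('a) - \<beta>)) \<le> u x"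
    proof (rule has_bochner_integral_mono_AE[OF _ potential], intro AE_I2)
      fix y
      show "(f x / B) * (indicator (ball x (norm x / 2)) y * norm (x - y) powr (- \<beta>)) \<le> f y * norm (x - y) powr (- \<beta>)"
      proof (cases "y \<in> ball x (norm x / 2)")
        case True
        then have "norm y \<le> norm x + norm x / 2"
          using norm_triangle_ineq3[of x y] by (simp add: dist_norm)
        then have "f x \<le> B * f y" using norm_ge_zero[of x] by (intro B(2)) linarith
        then have "f x / B \<le> f y" using B(1) by (simp add: field_simps)
        then have "f x / B * norm (x - y) powr (- \<beta>) \<le> f y * norm (x - y) powr (- \<beta>)"
            by (intro mult_right_mono) auto
          then show ?thesis using True by simp
      qed (use f_pos less_imp_le in \<open>auto intro!: mult_nonneg_nonneg\<close>)
    qed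
    moreover have "(norm x / 2) powr (DIM('a) - \<beta>) = norm x powr (DIM('a) - \<beta>) * (1/2) powr (DIM('a) - \<beta>)"
      using powr_mult[of "norm x" "1/2" "DIM('a) - \<beta>"] by simp
    ultimately show ?thesis by (simp add: c_def mult_ac)
  qed
  ultimately show ?thesis using that by blast
qed

text \<open>The ball of radius \<open>d * norm x\<close> contributes at most a multiple of
  \<open>f x * (d * norm x) powr (DIM('a) - \<beta>)\<close>, and
  \<open>potential_ball_lower\<close> converts this into a small fraction of \<open>u x\<close>
  itself. The function \<open>g\<close> is kept general because the part of the kernel removed by a
  truncation is what gets inserted.\<close>

lemma near_diagonal:
  assumes "power_decay a f" "a \<ge> 0"
  obtains C where "C > 0"
    "\<And>x d g I. \<lbrakk>x \<noteq> 0; 0 < d; d \<le> 1/2; has_bochner_integral lborel (\<lambda>y. f y * g y) I;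
       AE y in lborel. g y \<le> indicator (ball x (d * norm x)) y * norm (x - y) powr (- \<beta>)\<rbrakk> \<Longrightarrow>
       I \<le> C * d powr (DIM('a) - \<beta>) * u x"
proof -
  obtain B where B: "B \<ge> 1" "\<And>x y. norm y \<le> 1 + 2 * norm x \<Longrightarrow> f x \<le> B * f y"
    by (rule power_decay_ratio[OF assms]) blast
  obtain c where c: "c > 0" "\<And>x. c * (f x * norm x powr (DIM('a) - \<beta>)) \<le> u x"
    by (rule potential_ball_lower[OF assms]) blast
  define C where "C = B * ball_mass / c"
  have "C > 0" using B(1) ball_mass_pos c(1) by (simp add: C_def)
  moreover have "I \<le> C * d powr (DIM('a) - \<beta>) * u x"
    if x: "x \<noteq> 0" and d: "0 < d" "d \<le> 1/2" and I: "has_bochner_integral lborel (\<lambda>y. f y * g y) I"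
      and g: "AE y in lborel. g y \<le> indicator (ball x (d * norm x)) y * norm (x - y) powr (- \<beta>)"
    for x d g I
  proof -
    have r: "d * norm x > 0" using x d by simp
    have "has_bochner_integral lborel (\<lambda>y. (B * f x) * (indicator (ball x (d * norm x)) y * norm (x - y) powr (- \<beta>)))
        ((B * f x) * (ball_mass * (d * norm x) powr (DIM('a) - \<beta>)))"
      by (rule has_bochner_integral_mult_right) (use kernel_ball[OF r] in auto)
    with I have "I \<le> (B * f x) * (ball_mass * (d * norm x) powr (DIM('a) - \<beta>))"
    proof (rule has_bochner_integral_mono_AE)
      show "AE y in lborel. f y * g y \<le> (B * f x) * (indicator (ball x (d * norm x)) y * norm (x - y) powr (- \<beta>))"
        using g
      proof eventually_elim
        case (elim y)
        then have "f y * g y \<le> f y * (indicator (ball x (d * norm x)) y * norm (x - y) powr (- \<beta>))"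
          using f_pos[of y] by (intro mult_left_mono) auto
        also have "\<dots> \<le> (B * f x) * (indicator (ball x (d * norm x)) y * norm (x - y) powr (- \<beta>))"
        proof (cases "y \<in> ball x (d * norm x)")
          case True
          then have "norm (x - y) \<le> d * norm x" by (simp add: dist_norm)
          also have "\<dots> \<le> (1/2) * norm x" using d by (intro mult_right_mono) auto
          finally have "norm x \<le> 1 + 2 * norm y"
            using norm_triangle_ineq2[of x y] by (simp add: field_simps)
          then show ?thesis by (intro mult_right_mono B(2)) auto
        qed simp
        finally show ?case .
      qed
    qed
    also have "\<dots> = B * ball_mass * d powr (DIM('a) - \<beta>) * (f x * norm x powr (DIM('a) - \<beta>))"
      using d by (simp add: powr_mult mult_ac)
    also have "\<dots> \<le> B * ball_mass * d powr (DIM('a) - \<beta>) * (u x / c)"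
      using c B(1) ball_mass_pos by (intro mult_left_mono) (auto simp: field_simps)
    finally show ?thesis by (simp add: C_def field_simps)
  qed
  ultimately show ?thesis using that by blast
qed

text \<open>Scaling by \<open>norm x\<close> reduces the claim to bounding the integral of
  \<open>norm z powr (- a) * norm (e - z) powr (- \<beta>)\<close> uniformly over unit vectors
  \<open>e\<close>. It converges at 0, at \<open>e\<close> and at infinity because \<open>a\<close>
  and \<open>\<beta>\<close> are below the dimension and \<open>a + \<beta>\<close> is above it.
  Only an upper bound on \<open>f\<close> enters, so a smaller exponent than the true one may be
  used.\<close>

lemma potential_upper:
  fixes a C0 :: real
  assumes "(DIM('a) - \<beta>) < a" "a < DIM('a)" "C0 > 0" "\<And>y. f y \<le> C0 * (1 + norm y) powr (- a)"
  obtains C where "C > 0" "\<And>x. x \<noteq> 0 \<Longrightarrow> u x \<le> C * norm x powr ((DIM('a) - \<beta>) - a)"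
proof -
  let ?h1 = "\<lambda>z::'a. indicator (ball 0 1) z * norm z powr (- a)"
  let ?h2 = "\<lambda>z::'a. indicator (- ball 0 1) z * norm z powr (- (a + \<beta>))"
  let ?k = "\<lambda>(e::'a) (z::'a). indicator (ball e 1) z * norm (e - z) powr (- \<beta>)"
  \<comment> \<open>One term for each region: \<open>norm (e - z) > 1/2\<close> inside the unit
    ball; \<open>norm z \<ge> 1/2\<close> near \<open>e\<close>; and
    \<open>norm (e - z) \<ge> norm z / 3\<close> outside the unit ball and away from
    \<open>e\<close>. The integral of the majorant does not depend on \<open>e\<close>.\<close>
  define M where "M = 2 powr \<beta> * integral\<^sup>L lborel ?h1 + 2 powr a * ball_mass + 3 powr \<beta> * integral\<^sup>L lborel ?h2"
  have a: "a > 0" using assms(1) beta by simp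
  have h1: "has_bochner_integral lborel ?h1 (integral\<^sup>L lborel ?h1)"
    using integrable_norm_powr_unit_ball[of a, where 'a = 'a] assms a by (simp only: has_bochner_integral_iff)
  have h2: "has_bochner_integral lborel ?h2 (integral\<^sup>L lborel ?h2)"
    using integrable_norm_powr_outside_unit_ball[of "a + \<beta>", where 'a = 'a] assms
    by (simp add: has_bochner_integral_iff)
  have k: "has_bochner_integral lborel (?k e) ball_mass" for e
    using kernel_ball[of 1 e] by simp
  define G where "G = (\<lambda>e z. 2 powr \<beta> * ?h1 z + 2 powr a * ?k e z + 3 powr \<beta> * ?h2 z)"
  have G: "has_bochner_integral lborel (G e) M" for e
    unfolding G_def M_def
    by (intro has_bochner_integral_add has_bochner_integral_mult_right h1 h2 k)
  have bound: "norm z powr (- a) * norm (e - z) powr (- \<beta>) \<le> G e z" if e: "norm e = 1" and z: "z \<noteq> 0" "z \<noteq> e" for e z :: 'a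
  proof -
    have nn: "0 \<le> 2 powr \<beta> * ?h1 z" "0 \<le> 2 powr a * ?k e z" "0 \<le> 3 powr \<beta> * ?h2 z" by auto
    have tri: "1 \<le> norm z + norm (e - z)" "norm z \<le> 1 + norm (e - z)"
      using norm_triangle_ineq[of z "e - z"] norm_triangle_ineq[of e "z - e"] e by (auto simp: norm_minus_commute)
    have pos: "norm z > 0" "norm (e - z) > 0" using z by auto
    consider "norm (e - z) \<le> 1/2" | "norm (e - z) > 1/2" "norm z < 1" | "norm (e - z) > 1/2" "norm z \<ge> 1" by linarith
    then show ?thesis
    proof cases
      case 1
      then have "norm z powr (- a) \<le> (1/2) powr (- a)" using tri a by (intro powr_mono2') auto
      then have "norm z powr (- a) * norm (e - z) powr (- \<beta>) \<le> 2 powr a * norm (e - z) powr (- \<beta>)"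
        by (intro mult_right_mono) (auto simp: powr_minus powr_divide)
      also have "\<dots> = 2 powr a * ?k e z" using 1 by (simp add: dist_norm)
      finally show ?thesis using nn unfolding G_def by linarith
    next
      case 2
      then have "norm (e - z) powr (- \<beta>) \<le> (1/2) powr (- \<beta>)" using beta by (intro powr_mono2') auto
      then have "norm z powr (- a) * norm (e - z) powr (- \<beta>) \<le> norm z powr (- a) * 2 powr \<beta>"
        by (intro mult_left_mono) (auto simp: powr_minus powr_divide)
      also have "\<dots> = 2 powr \<beta> * ?h1 z" using 2 by simp
      finally show ?thesis using nn unfolding G_def by linarith
    next
      case 3
      then have "norm (e - z) powr (- \<beta>) \<le> (norm z / 3) powr (- \<beta>)" using tri beta by (intro powr_mono2') auto
      also have "\<dots> = 3 powr \<beta> * norm z powr (- \<beta>)" by (simp add: powr_divide powr_minus field_simps)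
      finally have "norm z powr (- a) * norm (e - z) powr (- \<beta>) \<le> norm z powr (- a) * (3 powr \<beta> * norm z powr (- \<beta>))"
        by (intro mult_left_mono) auto
      also have "\<dots> = 3 powr \<beta> * ?h2 z" using 3 powr_add[of "norm z" "- a" "- \<beta>"] by (simp add: algebra_simps)
      finally show ?thesis using nn unfolding G_def by linarith
    qed
  qed
  have "ball_mass > 0" by (rule ball_mass_pos)
  moreover have "integral\<^sup>L lborel ?h1 \<ge> 0" "integral\<^sup>L lborel ?h2 \<ge> 0" by (auto intro!: integral_nonneg_AE)
  ultimately have M: "M > 0" unfolding M_def by (intro add_pos_nonneg[OF add_nonneg_pos]) auto
  have "u x \<le> (C0 * M) * norm x powr ((DIM('a) - \<beta>) - a)" if x: "x \<noteq> 0" for x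
  proof -
    let ?r = "norm x"
    let ?e = "(1 / ?r) *\<^sub>R x"
    have r: "?r > 0" using x by simp
    have sc: "has_bochner_integral lborel (\<lambda>z. f (0 + ?r *\<^sub>R z) * norm (x - (0 + ?r *\<^sub>R z)) powr (- \<beta>)) (u x / ?r ^ DIM('a))"
      by (rule has_bochner_integral_lborel_affine[OF potential r])
    have "has_bochner_integral lborel (\<lambda>z. (C0 * ?r powr (- (a + \<beta>))) * G ?e z) ((C0 * ?r powr (- (a + \<beta>))) * M)"
      by (intro has_bochner_integral_mult_right G)
    with sc have "u x / ?r ^ DIM('a) \<le> (C0 * ?r powr (- (a + \<beta>))) * M"
    proof (rule has_bochner_integral_mono_AE)
      show "AE z in lborel. f (0 + ?r *\<^sub>R z) * norm (x - (0 + ?r *\<^sub>R z)) powr (- \<beta>) \<le> (C0 * ?r powr (- (a + \<beta>))) * G ?e z"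
        using AE_lborel_singleton[of 0] AE_lborel_singleton[of ?e]
      proof eventually_elim
        case (elim z)
        have "x - (0 + ?r *\<^sub>R z) = ?r *\<^sub>R (?e - z)" using r by (simp add: algebra_simps)
        then have n: "norm (x - (0 + ?r *\<^sub>R z)) = ?r * norm (?e - z)" by simp
        have "f (0 + ?r *\<^sub>R z) \<le> C0 * (1 + norm (?r *\<^sub>R z)) powr (- a)" using assms(4)[of "?r *\<^sub>R z"] by simp
        also have "\<dots> \<le> C0 * (?r * norm z) powr (- a)"
          using assms(3) a r elim by (intro mult_left_mono powr_mono2') auto
        finally have "f (0 + ?r *\<^sub>R z) * norm (x - (0 + ?r *\<^sub>R z)) powr (- \<beta>)
            \<le> C0 * (?r * norm z) powr (- a) * (?r * norm (?e - z)) powr (- \<beta>)"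
          unfolding n by (intro mult_right_mono) auto
        also have "\<dots> = (C0 * ?r powr (- (a + \<beta>))) * (norm z powr (- a) * norm (?e - z) powr (- \<beta>))"
          using powr_add[of "norm x" "- a" "- \<beta>"] by (simp add: powr_mult mult_ac)
        also have "\<dots> \<le> (C0 * ?r powr (- (a + \<beta>))) * G ?e z"
          using assms(3) elim r by (intro mult_left_mono bound) auto
        finally show ?case .
      qed
    qed
    then have "u x \<le> C0 * ?r powr (- (a + \<beta>)) * M * ?r powr DIM('a)"
      using r by (simp add: field_simps powr_realpow)
    also have "\<dots> = C0 * M * ?r powr ((DIM('a) - \<beta>) - a)"
      using powr_add[of "norm x" "- (a + \<beta>)" "DIM('a)"] by (simp add: algebra_simps)
    finally show ?thesis .
  qed
  then show ?thesis using that[of "C0 * M"] M assms(3) by auto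
qed


text \<open>The kernel is truncated at distance \<open>d * norm x\<close> from the diagonal. The truncated part is
  differentiated in \<open>x\<close> and costs \<open>(l - 1) / d\<close>; the remainder has small mass \<open>d powr \<alpha>\<close>, and there the
  dilation is moved onto \<open>f\<close>. The choice of \<open>d\<close> balances the two errors.\<close>
lemma dilation_regular_step:
  assumes "power_decay a f" "a \<ge> 0" "dilation_regular \<gamma> f" "0 \<le> \<gamma>" "\<gamma> \<le> 1"
  shows "dilation_regular ((\<gamma> + (DIM('a) - \<beta>)) / (1 + (DIM('a) - \<beta>))) u"
proof -
  define \<alpha> where "\<alpha> = DIM('a) - \<beta>"
  have alpha: "\<alpha> > 0" using beta by (simp add: \<alpha>_def)
  obtain B where B: "B \<ge> 1" "\<And>x l. l \<in> {1..2} \<Longrightarrow> f (l *\<^sub>R x) / f x \<in> {1 / B..B}"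
    by (rule dilation_bounds[OF assms(1,2)]) blast
  obtain C1 where C1: "C1 > 0"
    "\<And>x d g I. \<lbrakk>x \<noteq> 0; 0 < d; d \<le> 1/2; has_bochner_integral lborel (\<lambda>y. f y * g y) I;
       AE y in lborel. g y \<le> indicator (ball x (d * norm x)) y * norm (x - y) powr (- \<beta>)\<rbrakk> \<Longrightarrow>
       I \<le> C1 * d powr \<alpha> * u x"
    using near_diagonal[OF assms(1,2)] unfolding \<alpha>_def by blast
  obtain C2 where C2: "C2 > 0" "\<And>x l. l \<in> {1..2} \<Longrightarrow> \<bar>f (l *\<^sub>R x) - f x\<bar> \<le> C2 * (l - 1) powr \<gamma> * f x"
    using assms(3) unfolding dilation_regular_def by blast
  obtain L1 where L1: "L1 > 0" "\<And>z. 1/3 \<le> z \<Longrightarrow> z \<le> 3 \<Longrightarrow> \<bar>z powr (- \<beta>) - 1\<bar> \<le> L1 * \<bar>z - 1\<bar>"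
    using powr_lipschitz_at_1[of "1/3" 3 "- \<beta>"] by auto
  obtain L2 where L2: "L2 > 0" "\<And>z. 1 \<le> z \<Longrightarrow> z \<le> 2 \<Longrightarrow> \<bar>z powr \<alpha> - 1\<bar> \<le> L2 * \<bar>z - 1\<bar>"
    using powr_lipschitz_at_1[of 1 2 "\<alpha>"] by auto
  \<comment> \<open>Moving the dilation onto \<open>f\<close> produces the Jacobian and kernel
    factor \<open>l powr \<alpha>\<close>. The first term of \<open>E\<close> pays for it, using
    \<open>l - 1 \<le> (l - 1) powr \<gamma>\<close>; the second is the regularity constant of
    \<open>f\<close>.\<close>
  define E where "E = L2 * B + C2"
  have E: "E > 0" using L2 B(1) C2 by (simp add: E_def add_pos_pos)
  have fE: "\<bar>l powr \<alpha> * f (l *\<^sub>R x) - f x\<bar> \<le> E * (l - 1) powr \<gamma> * f x" if l: "1 < l" "l \<le> 2" for x l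
  proof -
    have l': "l \<in> {1..2}" using l by simp
    have "f (l *\<^sub>R x) \<le> B * f x" using B(2)[OF l', of x] f_pos[of x] by (simp add: field_simps)
    moreover have "\<bar>l powr \<alpha> - 1\<bar> \<le> L2 * (l - 1)" using L2(2)[of l] l by simp
    ultimately have "\<bar>l powr \<alpha> - 1\<bar> * f (l *\<^sub>R x) \<le> (L2 * (l - 1)) * (B * f x)"
      using less_imp_le[OF f_pos] L2(1) l by (intro mult_mono) auto
    also have "\<dots> = (l - 1) * (L2 * B * f x)" by (simp add: mult_ac)
    also have "\<dots> \<le> (l - 1) powr \<gamma> * (L2 * B * f x)"
    proof (rule mult_right_mono)
      have "(l - 1) powr 1 \<le> (l - 1) powr \<gamma>" using l assms by (intro powr_mono') auto
      then show "l - 1 \<le> (l - 1) powr \<gamma>" using l by simp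
    qed (use L2 B f_pos[of x] in auto)
    finally have 1: "\<bar>l powr \<alpha> - 1\<bar> * f (l *\<^sub>R x) \<le> (l - 1) powr \<gamma> * (L2 * B * f x)" .
    have "l powr \<alpha> * f (l *\<^sub>R x) - f x = (l powr \<alpha> - 1) * f (l *\<^sub>R x) + (f (l *\<^sub>R x) - f x)" by (simp add: algebra_simps)
    also have "\<bar>\<dots>\<bar> \<le> \<bar>l powr \<alpha> - 1\<bar> * f (l *\<^sub>R x) + \<bar>f (l *\<^sub>R x) - f x\<bar>"
      using abs_triangle_ineq[of "(l powr \<alpha> - 1) * f (l *\<^sub>R x)"] f_pos[of "l *\<^sub>R x"] by (simp add: abs_mult)
    also have "\<dots> \<le> (l - 1) powr \<gamma> * (L2 * B * f x) + C2 * (l - 1) powr \<gamma> * f x"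
      by (intro add_mono 1 C2(2) l')
    finally show ?thesis by (simp add: E_def algebra_simps)
  qed
  define C where "C = E * C1 * (1/2) powr \<alpha> + L1 * 2"
  have "C > 0" using E C1 L1 by (simp add: C_def add_pos_pos)
  moreover have "\<bar>u (l *\<^sub>R x) - u x\<bar> \<le> C * (l - 1) powr ((\<gamma> + \<alpha>) / (1 + \<alpha>)) * u x" if l12: "l \<in> {1..2}" for x l
  proof (cases "l = 1 \<or> x = 0")
    case True
    then show ?thesis using potential_pos[of x] \<open>C > 0\<close> by (auto intro!: mult_nonneg_nonneg)
  next
    case False
    then have l: "1 < l" "l \<le> 2" and x: "x \<noteq> 0" using l12 by auto
    define t where "t = l - 1"
    have t: "0 < t" "t \<le> 1" using l by (auto simp: t_def)
    \<comment> \<open>The errors \<open>t powr \<gamma> * d powr \<alpha>\<close> and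
      \<open>t / d\<close> have the same order when \<open>d powr (1 + \<alpha>)\<close> is of order
      \<open>t powr (1 - \<gamma>)\<close>. Halving \<open>t powr s\<close> keeps
      \<open>d \<le> 1/2\<close>, and \<open>s \<le> 1\<close> secures the condition
      \<open>t \<le> 2 * d\<close> of \<open>truncation_diff\<close>.\<close>
    define s where "s = (1 - \<gamma>) / (1 + \<alpha>)"
    have s: "0 \<le> s" "s \<le> 1" using assms alpha by (auto simp: s_def field_simps)
    define d where "d = t powr s / 2"
    have "t powr s \<le> 1 powr s" using t s by (intro powr_mono2) auto
    moreover have "t powr 1 \<le> t powr s" using t s by (intro powr_mono') auto
    ultimately have d: "0 < d" "d \<le> 1/2" "t \<le> 2 * d" using t by (auto simp: d_def)
    define K where "K = (\<lambda>x y::'a. max (norm (x - y)) (d * norm x) powr (- \<beta>))"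
    define k where "k = (\<lambda>x y::'a. norm (x - y) powr (- \<beta>))"
    have [measurable]: "K x \<in> borel_measurable borel" "k x \<in> borel_measurable borel" for x
      unfolding K_def k_def by measurable
    have ne: "AE y in lborel. y \<noteq> x" for x :: 'a by (rule AE_lborel_singleton)
    have K0: "0 \<le> K x y" for x y by (simp add: K_def)
    have Kk: "K x y \<le> k x y" if "y \<noteq> x" for x y
      unfolding K_def k_def using that beta by (intro powr_mono2') auto
    have pot: "has_bochner_integral lborel (\<lambda>y. f y * k x y) (u x)" for x
      using potential unfolding k_def .
    have intK: "integrable lborel (\<lambda>y. f y * K x y)" for x
    proof (rule Bochner_Integration.integrable_bound)
      show "integrable lborel (\<lambda>y. f y * k x y)" using pot by (simp add: has_bochner_integral_iff)
      show "AE y in lborel. norm (f y * K x y) \<le> norm (f y * k x y)"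
        using ne[of x]
      proof eventually_elim
        case (elim y)
        then have "\<bar>K x y\<bar> \<le> \<bar>k x y\<bar>" using Kk[of y x] K0[of x y] by linarith
        then show ?case using f_pos[of y] by (simp add: abs_mult)
      qed
    qed simp
    define F where "F = (\<lambda>x. LINT y|lborel. f y * K x y)"
    have F: "has_bochner_integral lborel (\<lambda>y. f y * K x y) (F x)" for x
      using intK by (simp add: F_def has_bochner_integral_iff)
    define n where "n = (\<lambda>x. u x - F x)"
    have n: "has_bochner_integral lborel (\<lambda>y. f y * (k x y - K x y)) (n x)" for x
      using has_bochner_integral_diff[OF pot F, of x] by (simp add: n_def right_diff_distrib)
    have F_le: "F x \<le> u x"
      by (rule has_bochner_integral_mono_AE[OF F pot])
        (use ne[of x] in eventually_elim, use Kk less_imp_le[OF f_pos] in \<open>auto intro!: mult_left_mono\<close>)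
    have n_le: "n x \<le> C1 * d powr \<alpha> * u x"
    proof (rule C1(2)[OF x d(1,2) n], use ne[of x] in eventually_elim)
      fix y assume "y \<noteq> x"
      show "k x y - K x y \<le> indicator (ball x (d * norm x)) y * norm (x - y) powr (- \<beta>)"
      proof (cases "norm (x - y) < d * norm x")
        case True
        then show ?thesis using K0[of x y] by (simp add: k_def dist_norm)
      next
        case False
        then have "K x y = k x y" by (simp add: K_def k_def max_def)
        then show ?thesis by simp
      qed
    qed
    have Fd: "\<bar>F (l *\<^sub>R x) - F x\<bar> \<le> L1 * (t / d) * F x"
    proof -
      have D: "has_bochner_integral lborel (\<lambda>y. f y * K (l *\<^sub>R x) y - f y * K x y) (F (l *\<^sub>R x) - F x)"
        by (rule has_bochner_integral_diff[OF F F])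
      have R: "has_bochner_integral lborel (\<lambda>y. (L1 * (t / d)) * (f y * K x y)) ((L1 * (t / d)) * F x)"
        by (rule has_bochner_integral_mult_right) (use F in auto)
      have le: "\<bar>f y * K (l *\<^sub>R x) y - f y * K x y\<bar> \<le> (L1 * (t / d)) * (f y * K x y)" for y
      proof -
        define z where "z = max (norm (l *\<^sub>R x - y)) (d * norm (l *\<^sub>R x)) / max (norm (x - y)) (d * norm x)"
        have m: "max (norm (x - y)) (d * norm x) > 0" using d x by (simp add: less_max_iff_disj)
        have z: "1/3 \<le> z" "z \<le> 3" "\<bar>z - 1\<bar> \<le> t / d"
          using truncation_diff[of d l x y] d x l unfolding z_def t_def by auto
        have "\<bar>z powr (- \<beta>) - 1\<bar> \<le> L1 * \<bar>z - 1\<bar>" by (rule L1(2)[OF z(1,2)])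
        also have "\<dots> \<le> L1 * (t / d)" using z(3) L1(1) by (intro mult_left_mono) auto
        finally have 1: "\<bar>z powr (- \<beta>) - 1\<bar> \<le> L1 * (t / d)" .
        have "max (norm (l *\<^sub>R x - y)) (d * norm (l *\<^sub>R x)) = z * max (norm (x - y)) (d * norm x)"
          using m by (simp add: z_def)
        then have "K (l *\<^sub>R x) y = z powr (- \<beta>) * K x y"
          using m z(1) unfolding K_def by (simp add: powr_mult)
        then have "f y * K (l *\<^sub>R x) y - f y * K x y = (z powr (- \<beta>) - 1) * (f y * K x y)"
          by (simp add: algebra_simps)
        moreover have "0 \<le> f y * K x y" using less_imp_le[OF f_pos] K0 by (intro mult_nonneg_nonneg) auto
        ultimately have "\<bar>f y * K (l *\<^sub>R x) y - f y * K x y\<bar> = \<bar>z powr (- \<beta>) - 1\<bar> * (f y * K x y)"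
          by (metis abs_mult abs_of_nonneg)
        also have "\<dots> \<le> (L1 * (t / d)) * (f y * K x y)"
          using 1 \<open>0 \<le> f y * K x y\<close> by (rule mult_right_mono)
        finally show ?thesis .
      qed
      have "F (l *\<^sub>R x) - F x \<le> L1 * (t / d) * F x"
        by (rule has_bochner_integral_mono_AE[OF D R]) (use le in \<open>auto simp: abs_le_iff\<close>)
      moreover have "- (F (l *\<^sub>R x) - F x) \<le> L1 * (t / d) * F x"
        by (rule has_bochner_integral_mono_AE[OF has_bochner_integral_minus[OF D] R]) (use le in \<open>auto simp: abs_le_iff\<close>)
      ultimately show ?thesis by linarith
    qed
    have nd: "\<bar>n (l *\<^sub>R x) - n x\<bar> \<le> E * t powr \<gamma> * n x"
    proof -
      \<comment> \<open>The truncation radius is proportional to \<open>norm x\<close>, so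
        \<open>K\<close> has the same homogeneity as \<open>k\<close>; a fixed radius would not
        allow the dilation to pass to \<open>f\<close>.\<close>
      have hom: "k (l *\<^sub>R x) (0 + l *\<^sub>R z) = l powr (- \<beta>) * k x z" "K (l *\<^sub>R x) (0 + l *\<^sub>R z) = l powr (- \<beta>) * K x z" for z
      proof -
        have "l *\<^sub>R x - (0 + l *\<^sub>R z) = l *\<^sub>R (x - z)" by (simp add: algebra_simps)
        then have e: "norm (l *\<^sub>R x - (0 + l *\<^sub>R z)) = l * norm (x - z)" using l by simp
        then show "k (l *\<^sub>R x) (0 + l *\<^sub>R z) = l powr (- \<beta>) * k x z" using l by (simp only: k_def powr_mult e)
        have "max (l * norm (x - z)) (d * norm (l *\<^sub>R x)) = l * max (norm (x - z)) (d * norm x)"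
          using l by (subst max_mult_distrib_left) (simp add: mult_ac)
        then show "K (l *\<^sub>R x) (0 + l *\<^sub>R z) = l powr (- \<beta>) * K x z" using l by (simp only: K_def powr_mult e)
      qed
      have "has_bochner_integral lborel (\<lambda>z. f (0 + l *\<^sub>R z) * (k (l *\<^sub>R x) (0 + l *\<^sub>R z) - K (l *\<^sub>R x) (0 + l *\<^sub>R z))) (n (l *\<^sub>R x) / l ^ DIM('a))"
        by (rule has_bochner_integral_lborel_affine[OF n]) (use l in simp)
      from has_bochner_integral_mult_right[OF this, of "l ^ DIM('a)"]
      have "has_bochner_integral lborel (\<lambda>z. l ^ DIM('a) * (f (l *\<^sub>R z) * (l powr (- \<beta>) * k x z - l powr (- \<beta>) * K x z))) (n (l *\<^sub>R x))"
        unfolding hom using l by simp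
      moreover have "l ^ DIM('a) * (f (l *\<^sub>R z) * (l powr (- \<beta>) * k x z - l powr (- \<beta>) * K x z))
          = l powr \<alpha> * f (l *\<^sub>R z) * (k x z - K x z)" for z
        using l powr_add[of l "DIM('a)" "- \<beta>"] by (simp add: \<alpha>_def powr_realpow[symmetric] algebra_simps)
      ultimately have "has_bochner_integral lborel (\<lambda>z. l powr \<alpha> * f (l *\<^sub>R z) * (k x z - K x z)) (n (l *\<^sub>R x))"
        by simp
      then have D: "has_bochner_integral lborel (\<lambda>z. l powr \<alpha> * f (l *\<^sub>R z) * (k x z - K x z) - f z * (k x z - K x z)) (n (l *\<^sub>R x) - n x)"
        by (rule has_bochner_integral_diff[OF _ n])
      have R: "has_bochner_integral lborel (\<lambda>y. (E * t powr \<gamma>) * (f y * (k x y - K x y))) ((E * t powr \<gamma>) * n x)"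
        by (rule has_bochner_integral_mult_right) (use n in auto)
      have le: "\<bar>l powr \<alpha> * f (l *\<^sub>R z) * (k x z - K x z) - f z * (k x z - K x z)\<bar> \<le> (E * t powr \<gamma>) * (f z * (k x z - K x z))" if "z \<noteq> x" for z
      proof -
        have "l powr \<alpha> * f (l *\<^sub>R z) * (k x z - K x z) - f z * (k x z - K x z) = (l powr \<alpha> * f (l *\<^sub>R z) - f z) * (k x z - K x z)"
          by (simp add: algebra_simps)
        moreover have "\<bar>l powr \<alpha> * f (l *\<^sub>R z) - f z\<bar> * (k x z - K x z) \<le> E * t powr \<gamma> * f z * (k x z - K x z)"
          using fE[OF l, of z] Kk[OF that] unfolding t_def by (intro mult_right_mono) auto
        moreover have "\<bar>k x z - K x z\<bar> = k x z - K x z" using Kk[OF that] by simp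
        ultimately show ?thesis by (simp add: abs_mult mult.assoc)
      qed
      have "n (l *\<^sub>R x) - n x \<le> E * t powr \<gamma> * n x"
        by (rule has_bochner_integral_mono_AE[OF D R], use ne[of x] in eventually_elim)
          (use le in \<open>auto simp: abs_le_iff\<close>)
      moreover have "- (n (l *\<^sub>R x) - n x) \<le> E * t powr \<gamma> * n x"
        by (rule has_bochner_integral_mono_AE[OF has_bochner_integral_minus[OF D] R], use ne[of x] in eventually_elim)
          (use le in \<open>auto simp: abs_le_iff\<close>)
      ultimately show ?thesis by linarith
    qed
    have "\<bar>u (l *\<^sub>R x) - u x\<bar> \<le> \<bar>n (l *\<^sub>R x) - n x\<bar> + \<bar>F (l *\<^sub>R x) - F x\<bar>"
      unfolding n_def by linarith
    also have "\<dots> \<le> E * t powr \<gamma> * n x + L1 * (t / d) * F x" by (intro add_mono nd Fd)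
    also have "\<dots> \<le> E * t powr \<gamma> * (C1 * d powr \<alpha> * u x) + L1 * (t / d) * u x"
      using E L1 t d by (intro add_mono mult_left_mono n_le F_le) auto
    also have "d powr \<alpha> = (1/2) powr \<alpha> * t powr (s * \<alpha>)"
      using t by (simp add: d_def powr_divide powr_powr)
    also have "t / d = 2 * t powr (1 - s)" using t by (simp add: d_def powr_diff)
    also have "1 - s = (\<gamma> + \<alpha>) / (1 + \<alpha>)" using alpha by (simp add: s_def field_simps)
    also have "E * t powr \<gamma> * (C1 * ((1/2) powr \<alpha> * t powr (s * \<alpha>)) * u x)
        = E * C1 * (1/2) powr \<alpha> * t powr (\<gamma> + s * \<alpha>) * u x" by (simp add: powr_add mult_ac)
    also have "\<gamma> + s * \<alpha> = (\<gamma> + \<alpha>) / (1 + \<alpha>)" using alpha by (simp add: s_def field_simps)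
    finally show ?thesis unfolding C_def t_def by (simp add: algebra_simps)
  qed
  ultimately show ?thesis unfolding dilation_regular_def \<alpha>_def by blast
qed

end

section \<open>Decay exponents of Riesz potentials\<close>

lemma power_decay_far:
  assumes "power_decay \<theta> v" "\<theta> \<ge> 0"
  obtains c C where "c > 0" "C > 0"
    "\<And>x. norm x \<ge> 1 \<Longrightarrow> c * norm x powr (- \<theta>) \<le> v x"
    "\<And>x. norm x \<ge> 1 \<Longrightarrow> v x \<le> C * norm x powr (- \<theta>)"
proof -
  obtain c C where c: "c > 0" "C > 0"
    and b: "\<And>x. c * (1 + norm x) powr (- \<theta>) \<le> v x" "\<And>x. v x \<le> C * (1 + norm x) powr (- \<theta>)"
    using assms(1) unfolding power_decay_def by blast
  have "(c * 2 powr (- \<theta>)) * norm x powr (- \<theta>) \<le> v x" if "norm x \<ge> 1" for x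
  proof -
    have "(2 * norm x) powr (- \<theta>) \<le> (1 + norm x) powr (- \<theta>)"
      using that assms(2) by (intro powr_mono2') (auto intro: add_pos_nonneg)
    then have "c * (2 * norm x) powr (- \<theta>) \<le> c * (1 + norm x) powr (- \<theta>)"
      using c by (intro mult_left_mono) auto
    then show ?thesis using b(1)[of x] by (simp add: powr_mult)
  qed
  moreover have "v x \<le> C * norm x powr (- \<theta>)" if "norm x \<ge> 1" for x
  proof -
    have "(1 + norm x) powr (- \<theta>) \<le> norm x powr (- \<theta>)"
      using that assms(2) by (intro powr_mono2') auto
    then have "C * (1 + norm x) powr (- \<theta>) \<le> C * norm x powr (- \<theta>)"
      using c by (intro mult_left_mono) auto
    then show ?thesis using b(2)[of x] by linarith
  qed
  moreover have "c * 2 powr (- \<theta>) > 0" using c by simp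
  ultimately show ?thesis using that c by blast
qed

section \<open>Comparison of exponents and integrability of the density\<close>

lemma powr_exponent_le:
  fixes c C s t :: real
  assumes "c > 0" "\<And>r. r \<ge> 1 \<Longrightarrow> c * r powr s \<le> C * r powr t"
  shows "s \<le> t"
proof (rule ccontr)
  assume "\<not> s \<le> t"
  then have st: "s - t > 0" by simp
  have C: "C \<ge> c" using assms(2)[of 1] by simp
  define r where "r = (C / c + 1) powr (1 / (s - t))"
  have r: "r \<ge> 1" unfolding r_def using C assms(1) st by (intro ge_one_powr_ge_zero) auto
  have "r powr (s - t) = C / c + 1"
    unfolding r_def powr_powr using st C assms(1) by (simp add: add_pos_pos)
  then have "r powr s = (C / c + 1) * r powr t" using r by (simp add: powr_diff field_simps)
  then have "c * r powr s = (C + c) * r powr t" using assms(1) by (simp add: field_simps)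
  then have "(C + c) * r powr t \<le> C * r powr t" using assms(2)[OF r] by simp
  then show False using assms(1) r by simp
qed

lemma norm_powr_exponent_le:
  fixes c C s t :: real
  assumes "c > 0" "\<And>x::'a::euclidean_space. norm x \<ge> 1 \<Longrightarrow> c * norm x powr s \<le> C * norm x powr t"
  shows "s \<le> t"
proof (rule powr_exponent_le[OF assms(1)])
  fix r :: real assume r: "r \<ge> 1"
  obtain b :: 'a where "b \<in> Basis" using nonempty_Basis by blast
  then have "norm (r *\<^sub>R b) = r" using r by simp
  then show "c * r powr s \<le> C * r powr t" using assms(2)[of "r *\<^sub>R b"] r by simp
qed

lemma integrable_if_bounded_on_balls:
  fixes h :: "'a::euclidean_space \<Rightarrow> real"
  assumes [measurable]: "h \<in> borel_measurable borel" and "\<And>x. h x \<ge> 0"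
    and I: "\<And>k::nat. \<exists>I. has_bochner_integral lborel (\<lambda>x. indicator (ball 0 (real k)) x * h x) I \<and> I \<le> M"
  shows "integrable lborel h"
proof (rule integrableI_bounded)
  have [measurable]: "ball (0::'a) (real k) \<in> sets borel" for k by simp
  have "ennreal (norm (h x)) = (SUP k. ennreal (indicator (ball 0 (real k)) x * h x))" for x
  proof (rule antisym)
    obtain k :: nat where "norm x < real k" using reals_Archimedean2 by blast
    then have "ennreal (norm (h x)) = ennreal (indicator (ball 0 (real k)) x * h x)" using assms(2)[of x] by simp
    then show "ennreal (norm (h x)) \<le> (SUP k. ennreal (indicator (ball 0 (real k)) x * h x))"
      by (rule ord_eq_le_trans) (rule SUP_upper, simp)
    show "(SUP k. ennreal (indicator (ball 0 (real k)) x * h x)) \<le> ennreal (norm (h x))"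
      using assms(2)[of x] by (intro SUP_least ennreal_leI) (auto simp: indicator_def)
  qed
  then have "(\<integral>\<^sup>+ x. ennreal (norm (h x)) \<partial>lborel) = (\<integral>\<^sup>+ x. (SUP k. ennreal (indicator (ball 0 (real k)) x * h x)) \<partial>lborel)"
    by simp
  also have "\<dots> = (SUP k. \<integral>\<^sup>+ x. ennreal (indicator (ball 0 (real k)) x * h x) \<partial>lborel)"
  proof (rule nn_integral_monotone_convergence_SUP)
    show "incseq (\<lambda>k x. ennreal (indicator (ball 0 (real k)) x * h x))"
      using assms(2) by (intro incseq_SucI le_funI ennreal_leI mult_right_mono) (auto simp: indicator_def)
    show "(\<lambda>x. ennreal (indicator (ball 0 (real k)) x * h x)) \<in> borel_measurable lborel" for k
      using I[of k] by (auto dest!: borel_measurable_has_bochner_integral)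
  qed
  also have "\<dots> \<le> ennreal M"
  proof (rule SUP_least)
    fix k
    obtain I' where I': "has_bochner_integral lborel (\<lambda>x. indicator (ball 0 (real k)) x * h x) I'" "I' \<le> M"
      using I[of k] by blast
    have "(\<integral>\<^sup>+ x. ennreal (indicator (ball 0 (real k)) x * h x) \<partial>lborel) = ennreal I'"
      using I'(1) assms(2) by (subst nn_integral_eq_integral) (auto simp: has_bochner_integral_iff)
    then show "(\<integral>\<^sup>+ x. ennreal (indicator (ball 0 (real k)) x * h x) \<partial>lborel) \<le> ennreal M"
      using I'(2) by (simp add: ennreal_leI)
  qed
  also have "\<dots> < \<infinity>" by simp
  finally show "(\<integral>\<^sup>+ x. ennreal (norm (h x)) \<partial>lborel) < \<infinity>" .
qed simp

context riesz
begin

text \<open>Seen from a point of norm \<open>k + 1\<close>, the kernel on the ball of radius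
  \<open>k\<close> is at least \<open>(2 * (k + 1)) powr (- \<beta>)\<close>. The assumed decay of
  \<open>u\<close> at that point cancels this factor and leaves a bound on the mass of
  \<open>f\<close> that is uniform in \<open>k\<close>.\<close>

lemma integrable_source:
  assumes "C > 0" "\<And>x. norm x \<ge> 1 \<Longrightarrow> u x \<le> C * norm x powr (- \<beta>)"
  shows "integrable lborel f"
proof (rule integrable_if_bounded_on_balls[where M = "C * 2 powr \<beta>"])
  fix k :: nat
  obtain b :: 'a where b: "b \<in> Basis" using nonempty_Basis by blast
  define r where "r = real k + 1"
  define x where "x = r *\<^sub>R b"
  have x: "norm x = r" "norm x \<ge> 1" using b by (auto simp: x_def r_def)
  define I where "I = (LINT y|lborel. indicator (ball 0 (real k)) y * f y)"
  have le: "AE y in lborel. indicator (ball 0 (real k)) y * f y \<le> (2 * r) powr \<beta> * (f y * norm (x - y) powr (- \<beta>))"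
    using AE_lborel_singleton[of x]
  proof eventually_elim
    case (elim y)
    show ?case
    proof (cases "y \<in> ball 0 (real k)")
      case True
      then have "norm (x - y) \<le> 2 * r" using norm_triangle_ineq4[of x y] x by (simp add: r_def)
      then have "(2 * r) powr (- \<beta>) \<le> norm (x - y) powr (- \<beta>)" using elim beta by (intro powr_mono2') auto
      then have "(2 * r) powr \<beta> * (2 * r) powr (- \<beta>) \<le> (2 * r) powr \<beta> * norm (x - y) powr (- \<beta>)"
        by (intro mult_left_mono) auto
      moreover have "(2 * r) powr \<beta> * (2 * r) powr (- \<beta>) = 1" by (simp add: powr_add[symmetric] r_def)
      ultimately have "f y * 1 \<le> f y * ((2 * r) powr \<beta> * norm (x - y) powr (- \<beta>))"
        using f_pos[of y] by (intro mult_left_mono) auto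
      then show ?thesis using True by (simp add: mult_ac)
    qed (use f_pos less_imp_le in \<open>auto intro!: mult_nonneg_nonneg\<close>)
  qed
  have R: "has_bochner_integral lborel (\<lambda>y. (2 * r) powr \<beta> * (f y * norm (x - y) powr (- \<beta>))) ((2 * r) powr \<beta> * u x)"
    by (rule has_bochner_integral_mult_right) (use potential in auto)
  have "integrable lborel (\<lambda>y. indicator (ball 0 (real k)) y * f y)"
  proof (rule Bochner_Integration.integrable_bound)
    show "integrable lborel (\<lambda>y. (2 * r) powr \<beta> * (f y * norm (x - y) powr (- \<beta>)))"
      using R by (simp only: has_bochner_integral_iff)
    show "AE y in lborel. norm (indicator (ball 0 (real k)) y * f y) \<le> norm ((2 * r) powr \<beta> * (f y * norm (x - y) powr (- \<beta>)))"
      using le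
    proof eventually_elim
      case (elim y)
      moreover have "0 \<le> indicator (ball 0 (real k)) y * f y" using less_imp_le[OF f_pos] by simp
      ultimately show ?case by simp
    qed
  qed (auto intro!: borel_measurable_times borel_measurable_indicator)
  then have I: "has_bochner_integral lborel (\<lambda>y. indicator (ball 0 (real k)) y * f y) I"
    by (simp add: has_bochner_integral_iff I_def)
  have "I \<le> (2 * r) powr \<beta> * u x" by (rule has_bochner_integral_mono_AE[OF I R le])
  also have "\<dots> \<le> (2 * r) powr \<beta> * (C * r powr (- \<beta>))"
    using assms(2)[OF x(2)] x by (intro mult_left_mono) auto
  also have "\<dots> = C * 2 powr \<beta> * (r powr \<beta> * r powr (- \<beta>))"
    unfolding powr_mult by (simp add: mult_ac)
  also have "r powr \<beta> * r powr (- \<beta>) = 1" by (simp add: r_def powr_add[symmetric])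
  finally show "\<exists>I. has_bochner_integral lborel (\<lambda>y. indicator (ball 0 (real k)) y * f y) I \<and> I \<le> C * 2 powr \<beta>"
    using I by auto
qed (use f_pos less_imp_le in auto)

text \<open>The two lower bounds on potentials give \<open>\<theta> \<le> \<beta>\<close> and
  \<open>\<theta> \<le> a - (DIM('a) - \<beta>)\<close>. The upper bound, applied with any
  admissible \<open>a' \<le> a\<close>, gives the reverse estimates.\<close>

lemma decay_exponent:
  assumes f: "power_decay a f" "a \<ge> 0" and u: "power_decay \<theta> u" "\<theta> > 0"
  shows "a < real DIM('a) \<and> \<theta> = a - (DIM('a) - \<beta>) \<or> a > real DIM('a) \<and> \<theta> = \<beta>"
proof -
  let ?n = "real DIM('a)"
  obtain c C where u_far: "c > 0" "C > 0"
    "\<And>x. norm x \<ge> 1 \<Longrightarrow> c * norm x powr (- \<theta>) \<le> u x"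
    "\<And>x. norm x \<ge> 1 \<Longrightarrow> u x \<le> C * norm x powr (- \<theta>)"
    by (rule power_decay_far[OF u(1) less_imp_le[OF u(2)]]) blast
  obtain c' C' where f_far: "c' > 0" "C' > 0"
    "\<And>x. norm x \<ge> 1 \<Longrightarrow> c' * norm x powr (- a) \<le> f x"
    "\<And>x. norm x \<ge> 1 \<Longrightarrow> f x \<le> C' * norm x powr (- a)"
    by (rule power_decay_far[OF f]) blast
  obtain c0 C0 where f_bd: "c0 > 0" "C0 > 0" "\<And>x. c0 * (1 + norm x) powr (- a) \<le> f x" "\<And>x. f x \<le> C0 * (1 + norm x) powr (- a)"
    using f(1) unfolding power_decay_def by blast
  have le_beta: "\<theta> \<le> \<beta>"
  proof -
    obtain b where b: "b > 0" "\<And>x. b * (1 + norm x) powr (- \<beta>) \<le> u x" by (rule potential_lower) blast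
    have "(b * 2 powr (- \<beta>)) * norm x powr (- \<beta>) \<le> C * norm x powr (- \<theta>)" if x: "norm x \<ge> 1" for x :: 'a
    proof -
      have "(2 * norm x) powr (- \<beta>) \<le> (1 + norm x) powr (- \<beta>)"
        using x beta by (intro powr_mono2') (auto intro: add_pos_nonneg)
      then have "b * (2 * norm x) powr (- \<beta>) \<le> b * (1 + norm x) powr (- \<beta>)"
        using b by (intro mult_left_mono) auto
      then show ?thesis using b(2)[of x] u_far(4)[OF x] by (simp add: powr_mult)
    qed
    then have "- \<beta> \<le> - \<theta>" by (rule norm_powr_exponent_le[rotated]) (simp_all add: b(1))
    then show ?thesis by simp
  qed
  have le_slow: "\<theta> \<le> a - (?n - \<beta>)"
  proof -
    obtain b where b: "b > 0" "\<And>x. b * (f x * norm x powr (?n - \<beta>)) \<le> u x" by (rule potential_ball_lower[OF f]) blast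
    have "(b * c') * norm x powr (- a + (?n - \<beta>)) \<le> C * norm x powr (- \<theta>)" if x: "norm x \<ge> 1" for x :: 'a
    proof -
      have "(b * c') * norm x powr (- a + (?n - \<beta>)) = b * ((c' * norm x powr (- a)) * norm x powr (?n - \<beta>))"
        unfolding powr_add by (simp add: mult_ac)
      also have "\<dots> \<le> b * (f x * norm x powr (?n - \<beta>))"
        using f_far(3)[OF x] b(1) by (intro mult_left_mono mult_right_mono) auto
      finally show ?thesis using b(2)[of x] u_far(4)[OF x] by linarith
    qed
    then have "- a + (?n - \<beta>) \<le> - \<theta>" by (rule norm_powr_exponent_le[rotated]) (simp_all add: b(1) f_far(1))
    then show ?thesis by simp
  qed
  have ge: "\<theta> \<ge> a' - (?n - \<beta>)" if a': "a' \<le> a" "?n - \<beta> < a'" "a' < ?n" for a'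
  proof -
    have "f y \<le> C0 * (1 + norm y) powr (- a')" for y
    proof -
      have "(1 + norm y) powr (- a) \<le> (1 + norm y) powr (- a')" using a' by (intro powr_mono) auto
      then have "C0 * (1 + norm y) powr (- a) \<le> C0 * (1 + norm y) powr (- a')"
        using f_bd(2) by (intro mult_left_mono) auto
      then show ?thesis using f_bd(4)[of y] by linarith
    qed
    then obtain D where D: "D > 0" "\<And>x. x \<noteq> 0 \<Longrightarrow> u x \<le> D * norm x powr (?n - \<beta> - a')"
      using potential_upper[OF a'(2,3) f_bd(2)] by blast
    have "c * norm x powr (- \<theta>) \<le> D * norm x powr (?n - \<beta> - a')" if x: "norm x \<ge> 1" for x :: 'a
      using u_far(3)[OF x] D(2)[of x] x by force
    then have "- \<theta> \<le> ?n - \<beta> - a'" by (rule norm_powr_exponent_le[OF u_far(1)])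
    then show ?thesis by simp
  qed
  \<comment> \<open>\<open>potential_upper\<close> excludes \<open>a' = ?n\<close>, so the bound is
    obtained as a limit of smaller exponents.\<close>
  have ge_beta: "\<theta> \<ge> \<beta>" if "a \<ge> ?n"
  proof (rule dense_le_bounded[of 0])
    fix y assume "0 < y" "y < \<beta>"
    then show "y \<le> \<theta>" using ge[of "y + (?n - \<beta>)"] that by simp
  qed (rule beta)
  consider "a < ?n" | "a = ?n" | "a > ?n" by linarith
  then show ?thesis
  proof cases
    case 1
    \<comment> \<open>\<open>\<theta> > 0\<close> and \<open>le_slow\<close> force
      \<open>a > ?n - \<beta>\<close>, so \<open>a' = a\<close> is admissible.\<close>
    then show ?thesis using le_slow ge[of a] u(2) by simp
  next
    case 2
    \<comment> \<open>In the borderline case \<open>u\<close> would decay like the kernel, making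
      \<open>f\<close> integrable, although \<open>f\<close> is bounded below by a multiple of a
      function that is not.\<close>
    with le_beta ge_beta have "\<theta> = \<beta>" by simp
    then have "integrable lborel f" using integrable_source[OF u_far(2)] u_far(4) by simp
    then have "integrable lborel (\<lambda>x. (1/c0) * f x)" by simp
    then have "integrable lborel (\<lambda>y::'a. (1 + norm y) powr (- ?n))"
    proof (rule Bochner_Integration.integrable_bound)
      have "norm ((1 + norm y) powr (- ?n)) \<le> norm (1 / c0 * f y)" for y
        using f_bd(3)[of y] f_bd(1) f_pos[of y] unfolding 2 by (simp add: field_simps)
      then show "AE y in lborel. norm ((1 + norm y) powr (- ?n)) \<le> norm (1 / c0 * f y)" by simp
    qed simp
    then show ?thesis using not_integrable_one_plus_norm_powr by blast
  next
    case 3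
    then show ?thesis using le_beta ge_beta by simp
  qed
qed

end

section \<open>The Pohozaev identity\<close>

lemma riesz_dilation:
  fixes f u :: "'a::euclidean_space \<Rightarrow> real"
  assumes "riesz \<beta> f u" "l > 0"
  shows "riesz \<beta> (\<lambda>x. f (l *\<^sub>R x)) (\<lambda>x. l powr (\<beta> - DIM('a)) * u (l *\<^sub>R x))"
proof -
  interpret riesz \<beta> f u by fact
  show ?thesis
  proof
    fix x :: 'a
    have n: "norm (l *\<^sub>R x - (0 + l *\<^sub>R z)) = l * norm (x - z)" for z
    proof -
      have "l *\<^sub>R x - (0 + l *\<^sub>R z) = l *\<^sub>R (x - z)" by (simp add: algebra_simps)
      then show ?thesis using assms(2) by simp
    qed
    have "has_bochner_integral lborel (\<lambda>z. f (0 + l *\<^sub>R z) * norm (l *\<^sub>R x - (0 + l *\<^sub>R z)) powr (- \<beta>)) (u (l *\<^sub>R x) / l ^ DIM('a))"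
      by (rule has_bochner_integral_lborel_affine[OF potential assms(2)])
    from has_bochner_integral_mult_right[OF this, of "l powr \<beta>"]
    have "has_bochner_integral lborel (\<lambda>z. l powr \<beta> * (f (0 + l *\<^sub>R z) * norm (l *\<^sub>R x - (0 + l *\<^sub>R z)) powr (- \<beta>)))
       (l powr \<beta> * (u (l *\<^sub>R x) / l ^ DIM('a)))" by blast
    moreover have "l powr \<beta> * (f (0 + l *\<^sub>R z) * norm (l *\<^sub>R x - (0 + l *\<^sub>R z)) powr (- \<beta>)) = f (l *\<^sub>R z) * norm (x - z) powr (- \<beta>)" for z
      unfolding n powr_mult using assms(2) by (simp add: powr_minus)
    moreover have "l powr \<beta> * (u (l *\<^sub>R x) / l ^ DIM('a)) = l powr (\<beta> - DIM('a)) * u (l *\<^sub>R x)"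
      using assms(2) by (simp add: powr_diff powr_realpow)
    ultimately show "has_bochner_integral lborel (\<lambda>z. f (l *\<^sub>R z) * norm (x - z) powr (- \<beta>)) (l powr (\<beta> - DIM('a)) * u (l *\<^sub>R x))"
      by (simp only:)
  qed (use beta f_pos in auto)
qed

text \<open>Tonelli for the symmetric kernel. Nonnegative extended integrals let the order be
  exchanged before finiteness of either side is known.\<close>

lemma riesz_symmetric:
  fixes f u g w :: "'a::euclidean_space \<Rightarrow> real"
  assumes "riesz \<beta> f u" "riesz \<beta> g w"
  shows "(\<integral>\<^sup>+ x. ennreal (g x * u x) \<partial>lborel) = (\<integral>\<^sup>+ y. ennreal (f y * w y) \<partial>lborel)"
proof -
  interpret f: riesz \<beta> f u by fact
  interpret g: riesz \<beta> g w by fact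
  have f0: "0 \<le> f x" and g0: "0 \<le> g x" for x using f.f_pos g.f_pos less_imp_le by auto
  have [measurable]: "f \<in> borel_measurable borel" "g \<in> borel_measurable borel"
    by (rule f.f_measurable g.f_measurable)+
  have u: "ennreal (g x * u x) = (\<integral>\<^sup>+ y. ennreal (g x * f y * norm (x - y) powr (- \<beta>)) \<partial>lborel)" for x
  proof -
    have "has_bochner_integral lborel (\<lambda>y. g x * (f y * norm (x - y) powr (- \<beta>))) (g x * u x)"
      by (rule has_bochner_integral_mult_right) (use f.potential in auto)
    then show ?thesis using f0 g0 by (subst nn_integral_eq_integral) (auto simp: has_bochner_integral_iff mult.assoc)
  qed
  have w: "ennreal (f y * w y) = (\<integral>\<^sup>+ x. ennreal (g x * f y * norm (x - y) powr (- \<beta>)) \<partial>lborel)" for y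
  proof -
    have "has_bochner_integral lborel (\<lambda>x. f y * (g x * norm (y - x) powr (- \<beta>))) (f y * w y)"
      by (rule has_bochner_integral_mult_right) (use g.potential in auto)
    then have "has_bochner_integral lborel (\<lambda>x. g x * f y * norm (x - y) powr (- \<beta>)) (f y * w y)"
      by (simp add: mult_ac norm_minus_commute)
    then show ?thesis using f0 g0 by (subst nn_integral_eq_integral) (auto simp: has_bochner_integral_iff)
  qed
  show ?thesis
    unfolding u w by (rule lborel_pair.Fubini'[symmetric]) measurable
qed

text \<open>With the coefficient \<open>s / m\<close> both expressions have value 1 and derivative
  \<open>s\<close> at 1. The derivative of the difference is then at most a multiple of the distance
  to 1, and the mean value theorem supplies the second factor.\<close>

lemma powr_expansion_at_1:
  fixes a b s m :: real
  assumes "0 < a" "a \<le> 1" "1 \<le> b" "0 < s" "0 < m"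
  obtains M where "M > 0"
    "\<And>z. a \<le> z \<Longrightarrow> z \<le> b \<Longrightarrow> \<bar>z powr s - ((s / m) * z powr m + (1 - s / m))\<bar> \<le> M * (z - 1)\<^sup>2"
proof -
  obtain L1 where L1: "L1 > 0" "\<And>z. a \<le> z \<Longrightarrow> z \<le> b \<Longrightarrow> \<bar>z powr (s - 1) - 1\<bar> \<le> L1 * \<bar>z - 1\<bar>"
    using powr_lipschitz_at_1[OF assms(1-3), of "s - 1"] by blast
  obtain L2 where L2: "L2 > 0" "\<And>z. a \<le> z \<Longrightarrow> z \<le> b \<Longrightarrow> \<bar>z powr (m - 1) - 1\<bar> \<le> L2 * \<bar>z - 1\<bar>"
    using powr_lipschitz_at_1[OF assms(1-3), of "m - 1"] by blast
  define M where "M = s * (L1 + L2)"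
  let ?h = "\<lambda>z. z powr s - ((s / m) * z powr m + (1 - s / m))"
  have "\<bar>?h z\<bar> \<le> M * (z - 1)\<^sup>2" if z: "a \<le> z" "z \<le> b" for z
  proof -
    have "norm (?h z - ?h 1) \<le> M * \<bar>z - 1\<bar> * norm (z - 1)"
    proof (rule field_differentiable_bound[where S = "{min 1 z..max 1 z}" and f' = "\<lambda>y. s * (y powr (s - 1) - y powr (m - 1))"])
      fix y assume y: "y \<in> {min 1 z..max 1 z}"
      then have y': "0 < y" "a \<le> y" "y \<le> b" "\<bar>y - 1\<bar> \<le> \<bar>z - 1\<bar>" using z assms by (auto simp: min_def max_def split: if_splits)
      show "(?h has_field_derivative s * (y powr (s - 1) - y powr (m - 1))) (at y within {min 1 z..max 1 z})"
        using y' assms by (auto intro!: derivative_eq_intros simp: algebra_simps)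
      have "\<bar>y powr (s - 1) - y powr (m - 1)\<bar> \<le> \<bar>y powr (s - 1) - 1\<bar> + \<bar>y powr (m - 1) - 1\<bar>" by linarith
      also have "\<dots> \<le> L1 * \<bar>y - 1\<bar> + L2 * \<bar>y - 1\<bar>" by (intro add_mono L1 L2 y')
      also have "\<dots> = (L1 + L2) * \<bar>y - 1\<bar>" by (simp add: algebra_simps)
      also have "\<dots> \<le> (L1 + L2) * \<bar>z - 1\<bar>" using L1 L2 y' by (intro mult_left_mono) auto
      finally have "s * \<bar>y powr (s - 1) - y powr (m - 1)\<bar> \<le> s * ((L1 + L2) * \<bar>z - 1\<bar>)"
        using assms by (intro mult_left_mono) auto
      then show "norm (s * (y powr (s - 1) - y powr (m - 1))) \<le> M * \<bar>z - 1\<bar>"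
        using assms by (simp add: M_def abs_mult mult.assoc)
    qed auto
    also have "M * \<bar>z - 1\<bar> * norm (z - 1) = M * (z - 1)\<^sup>2" by (simp add: power2_eq_square mult.assoc)
    finally show ?thesis by simp
  qed
  moreover have "M > 0" using assms L1 L2 by (simp add: M_def)
  ultimately show ?thesis using that by blast
qed

text \<open>Only a Hoelder bound for \<open>w\<close> is available, but the first-order term in
  \<open>z = w (l *\<^sub>R x) / w x\<close> can be replaced by that of \<open>z powr m\<close>, whose integral is explicit.
  The error is then quadratic in the Hoelder bound.\<close>
lemma dilation_correlation:
  fixes w :: "'a::euclidean_space \<Rightarrow> real"
  assumes w: "power_decay \<theta> w" "\<theta> \<ge> 0" "dilation_regular \<gamma> w"
    and [measurable]: "w \<in> borel_measurable borel"
    and int: "integrable lborel (\<lambda>x. w x powr m)"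
    and s: "0 < s" "s < m"
  obtains C where "C > 0"
    "\<And>l. l \<in> {1..2} \<Longrightarrow> integrable lborel (\<lambda>x. w (l *\<^sub>R x) powr s * w x powr (m - s))"
    "\<And>l. l \<in> {1..2} \<Longrightarrow> \<bar>(LINT x|lborel. w (l *\<^sub>R x) powr s * w x powr (m - s))
        - ((s / m) * l powr (- real DIM('a)) + (1 - s / m)) * (LINT x|lborel. w x powr m)\<bar> \<le> C * (l - 1) powr (2 * \<gamma>)"
proof -
  define A where "A = (LINT x|lborel. w x powr m)"
  have A: "has_bochner_integral lborel (\<lambda>x. w x powr m) A" using int by (simp add: A_def has_bochner_integral_iff)
  have A0: "A \<ge> 0" unfolding A_def by (intro integral_nonneg_AE) auto
  have m: "m > 0" using s by simp
  obtain B where B: "B \<ge> 1" "\<And>x l. l \<in> {1..2} \<Longrightarrow> w (l *\<^sub>R x) / w x \<in> {1 / B..B}"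
    by (rule dilation_bounds[OF w(1,2)]) blast
  obtain M where M: "M > 0" "\<And>z. 1 / B \<le> z \<Longrightarrow> z \<le> B \<Longrightarrow> \<bar>z powr s - ((s / m) * z powr m + (1 - s / m))\<bar> \<le> M * (z - 1)\<^sup>2"
    using powr_expansion_at_1[of "1 / B" B s m] B(1) s m by auto
  obtain K where K: "K > 0" "\<And>x l. l \<in> {1..2} \<Longrightarrow> \<bar>w (l *\<^sub>R x) - w x\<bar> \<le> K * (l - 1) powr \<gamma> * w x"
    using w(3) unfolding dilation_regular_def by blast
  have wpos: "w x > 0" for x by (rule power_decay_pos[OF w(1)])
  \<comment> \<open>Only \<open>A \<ge> 0\<close> is at hand here; the summand 1 makes
    \<open>C\<close> strictly positive.\<close>
  define C where "C = M * K\<^sup>2 * A + 1"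
  have Cpos: "C > 0" using M K A0 by (simp add: C_def add_nonneg_pos)
  have main: "integrable lborel (\<lambda>x. w (l *\<^sub>R x) powr s * w x powr (m - s)) \<and>
      \<bar>(LINT x|lborel. w (l *\<^sub>R x) powr s * w x powr (m - s))
        - ((s / m) * l powr (- real DIM('a)) + (1 - s / m)) * A\<bar> \<le> C * (l - 1) powr (2 * \<gamma>)" if l: "l \<in> {1..2}" for l
  proof -
    have l0: "l > 0" using l by simp
    define \<epsilon> where "\<epsilon> = M * K\<^sup>2 * (l - 1) powr (2 * \<gamma>)"
    have \<epsilon>: "\<epsilon> \<ge> 0" using M by (simp add: \<epsilon>_def)
    have sc: "has_bochner_integral lborel (\<lambda>x. w (l *\<^sub>R x) powr m) (l powr (- real DIM('a)) * A)"
      using has_bochner_integral_lborel_affine[OF A l0, of 0] l0 by (simp add: powr_minus powr_realpow divide_inverse mult.commute)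
    define P where "P = (\<lambda>x. (s / m) * w (l *\<^sub>R x) powr m + (1 - s / m) * w x powr m)"
    have P: "has_bochner_integral lborel P ((s / m) * (l powr (- real DIM('a)) * A) + (1 - s / m) * A)"
      unfolding P_def by (intro has_bochner_integral_add has_bochner_integral_mult_right sc A)
    define Q where "Q = (\<lambda>x. w (l *\<^sub>R x) powr s * w x powr (m - s))"
    have QP: "\<bar>Q x - P x\<bar> \<le> \<epsilon> * w x powr m" for x
    proof -
      define z where "z = w (l *\<^sub>R x) / w x"
      have z: "1 / B \<le> z" "z \<le> B" "z > 0" using B(2)[OF l, of x] wpos by (auto simp: z_def)
      have wz: "w (l *\<^sub>R x) = z * w x" using wpos[of x] by (simp add: z_def)
      have "\<bar>z - 1\<bar> * w x = \<bar>w (l *\<^sub>R x) - w x\<bar>"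
        using wpos[of x] by (simp add: abs_mult_pos[OF less_imp_le, of "w x"] wz left_diff_distrib)
      also have "\<dots> \<le> K * (l - 1) powr \<gamma> * w x" by (rule K(2)[OF l])
      finally have "\<bar>z - 1\<bar> \<le> K * (l - 1) powr \<gamma>" using wpos[of x] by simp
      then have "(z - 1)\<^sup>2 \<le> (K * (l - 1) powr \<gamma>)\<^sup>2" by (simp add: abs_le_square_iff[symmetric])
      also have "\<dots> = K\<^sup>2 * (l - 1) powr (2 * \<gamma>)"
        by (simp add: power_mult_distrib power2_eq_square powr_add[symmetric])
      finally have "\<bar>z powr s - ((s / m) * z powr m + (1 - s / m))\<bar> \<le> M * (K\<^sup>2 * (l - 1) powr (2 * \<gamma>))"
        using M(2)[OF z(1,2)] M(1) by (meson mult_left_mono less_imp_le order_trans)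
      then have "\<bar>z powr s - ((s / m) * z powr m + (1 - s / m))\<bar> * w x powr m \<le> \<epsilon> * w x powr m"
        by (intro mult_right_mono) (auto simp: \<epsilon>_def mult.assoc)
      moreover have "Q x - P x = (z powr s - ((s / m) * z powr m + (1 - s / m))) * w x powr m"
      proof -
        have "w x powr s * w x powr (m - s) = w x powr m" by (simp add: powr_add[symmetric])
        then have "Q x = z powr s * w x powr m" by (simp add: Q_def wz powr_mult mult.assoc)
        moreover have "P x = ((s / m) * z powr m + (1 - s / m)) * w x powr m" by (simp add: P_def wz powr_mult distrib_right)
        ultimately show ?thesis by (simp add: left_diff_distrib)
      qed
      ultimately show ?thesis by (simp add: abs_mult)
    qed
    have R: "has_bochner_integral lborel (\<lambda>x. \<epsilon> * w x powr m) (\<epsilon> * A)"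
      by (intro has_bochner_integral_mult_right A)
    have "integrable lborel (\<lambda>x. Q x - P x)"
    proof (rule Bochner_Integration.integrable_bound)
      show "integrable lborel (\<lambda>x. \<epsilon> * w x powr m)" using R by (simp only: has_bochner_integral_iff)
      show "AE x in lborel. norm (Q x - P x) \<le> norm (\<epsilon> * w x powr m)" using QP \<epsilon> by simp
    qed (simp add: Q_def P_def)
    then have "integrable lborel (\<lambda>x. (Q x - P x) + P x)"
      using P by (intro Bochner_Integration.integrable_add) (auto simp: has_bochner_integral_iff)
    then have intQ: "integrable lborel Q" by simp
    then have Q: "has_bochner_integral lborel Q (integral\<^sup>L lborel Q)" by (simp add: has_bochner_integral_iff)
    define D where "D = integral\<^sup>L lborel Q - ((s / m) * (l powr (- real DIM('a)) * A) + (1 - s / m) * A)"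
    have D: "has_bochner_integral lborel (\<lambda>x. Q x - P x) D"
      unfolding D_def by (rule has_bochner_integral_diff[OF Q P])
    have "D \<le> \<epsilon> * A"
      by (rule has_bochner_integral_mono_AE[OF D R]) (use QP in \<open>auto simp: abs_le_iff\<close>)
    moreover have "- D \<le> \<epsilon> * A"
      by (rule has_bochner_integral_mono_AE[OF has_bochner_integral_minus[OF D] R]) (use QP in \<open>auto simp: abs_le_iff\<close>)
    ultimately have "\<bar>D\<bar> \<le> \<epsilon> * A" by linarith
    also have "\<dots> \<le> C * (l - 1) powr (2 * \<gamma>)" by (simp add: C_def \<epsilon>_def algebra_simps)
    finally show ?thesis using intQ by (simp add: D_def Q_def algebra_simps)
  qed
  show ?thesis by (rule that[OF Cpos]) (use main in \<open>auto simp: A_def\<close>)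
qed

text \<open>The right difference quotient already determines the derivative. The bound at
  \<open>l = 1\<close> reads \<open>h 1 = 0\<close>, because \<open>0 powr e = 0\<close>.\<close>

lemma derivative_zero_if_superlinear:
  fixes h :: "real \<Rightarrow> real"
  assumes "(h has_real_derivative D) (at 1)" "e > 1"
    and b: "\<And>l. l \<in> {1..2} \<Longrightarrow> \<bar>h l\<bar> \<le> C * (l - 1) powr e"
  shows "D = 0"
proof -
  have h1: "h 1 = 0" using b[of 1] by simp
  have "((\<lambda>t. (h (1 + t) - h 1) / t) \<longlongrightarrow> D) (at 0)" using assms(1) by (simp add: DERIV_def)
  then have 1: "((\<lambda>t. (h (1 + t) - h 1) / t) \<longlongrightarrow> D) (at_right 0)" by (rule filterlim_mono) (auto simp: at_le)
  have "((\<lambda>t. C * t powr (e - 1)) \<longlongrightarrow> C * 0 powr (e - 1)) (at_right 0)"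
    using assms(2) by (intro tendsto_intros tendsto_powr2) (auto simp: eventually_at_filter)
  then have 2: "((\<lambda>t. C * t powr (e - 1)) \<longlongrightarrow> 0) (at_right 0)" using assms(2) by simp
  have "((\<lambda>t. (h (1 + t) - h 1) / t) \<longlongrightarrow> 0) (at_right 0)"
  proof (rule Lim_null_comparison[OF _ 2])
    have "\<forall>\<^sub>F t in at_right 0. t \<in> {0<..<1::real}" by (rule eventually_at_right_real) simp
    then show "\<forall>\<^sub>F t in at_right 0. norm ((h (1 + t) - h 1) / t) \<le> C * t powr (e - 1)"
    proof eventually_elim
      case (elim t)
      then have "\<bar>h (1 + t)\<bar> \<le> C * t powr e" using b[of "1 + t"] by simp
      then show ?case using elim h1 by (simp add: powr_diff field_simps)
    qed
  qed
  with 1 show "D = 0" using tendsto_unique by (metis trivial_limit_at_right_real)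
qed

text \<open>\<open>F\<close> and \<open>G\<close> are never differentiated. They are replaced by
  explicit functions up to a superlinear error, and only the explicit combination \<open>h\<close>
  is differentiated at 1.\<close>

lemma pohozaev_critical:
  fixes u v :: "'a::euclidean_space \<Rightarrow> real"
  assumes R1: "riesz \<beta> (\<lambda>y. v y powr q) u" and R2: "riesz \<beta> (\<lambda>y. u y powr p) v"
    and [measurable]: "u \<in> borel_measurable borel" "v \<in> borel_measurable borel"
    and pq: "p > 0" "q > 0"
    and decay: "power_decay \<theta>1 u" "\<theta>1 \<ge> 0" "power_decay \<theta>2 v" "\<theta>2 \<ge> 0"
    and int: "integrable lborel (\<lambda>x. u x powr (p + 1))" "integrable lborel (\<lambda>x. v x powr (q + 1))"
  shows "1 / (p + 1) + 1 / (q + 1) = \<beta> / DIM('a)"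
proof -
  let ?n = "real DIM('a)"
  interpret R1: riesz \<beta> "\<lambda>y. v y powr q" u by fact
  interpret R2: riesz \<beta> "\<lambda>y. u y powr p" v by fact
  have n: "?n > 0" by simp
  define \<alpha> where "\<alpha> = ?n - \<beta>"
  have alpha: "\<alpha> > 0" using R1.beta by (simp add: \<alpha>_def)
  have upos: "u x > 0" and vpos: "v x > 0" for x by (rule R1.potential_pos R2.potential_pos)+
  define \<rho> where "\<rho> = 1 / (1 + \<alpha>)"
  have rho: "0 < \<rho>" "\<rho> < 1" using alpha by (auto simp: \<rho>_def)
  have reg: "dilation_regular (1 - \<rho> ^ k) u \<and> dilation_regular (1 - \<rho> ^ k) v" for k
  proof (induction k)
    case 0
    show ?case using decay by (simp add: dilation_regular_0)
  next
    case (Suc k)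
    have g: "0 \<le> 1 - \<rho> ^ k" "1 - \<rho> ^ k \<le> 1" using rho by (auto simp: power_le_one)
    have e: "(1 - \<rho> ^ k + (?n - \<beta>)) / (1 + (?n - \<beta>)) = 1 - \<rho> ^ Suc k"
    proof -
      have "(1 - x + \<alpha>) / (1 + \<alpha>) = 1 - \<rho> * x" for x using alpha by (simp add: \<rho>_def field_simps)
      then show ?thesis by (simp add: \<alpha>_def)
    qed
    have "dilation_regular (1 - \<rho> ^ Suc k) u"
      using R1.dilation_regular_step[OF power_decay_powr[OF decay(3) pq(2)] _ dilation_regular_powr[OF decay(3,4)] g]
        Suc.IH decay pq unfolding e by auto
    moreover have "dilation_regular (1 - \<rho> ^ Suc k) v"
      using R2.dilation_regular_step[OF power_decay_powr[OF decay(1) pq(1)] _ dilation_regular_powr[OF decay(1,2)] g]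
        Suc.IH decay pq unfolding e by auto
    ultimately show ?case by blast
  qed
  \<comment> \<open>After \<open>k\<close> rounds the gap to exponent 1 is
    \<open>\<rho> ^ k\<close>; below 1/2 it makes \<open>2 * \<gamma>\<close> exceed 1.\<close>
  obtain k where k: "\<rho> ^ k < 1/2" using real_arch_pow_inv[of "1/2" \<rho>] rho by auto
  define \<gamma> where "\<gamma> = 1 - \<rho> ^ k"
  have gamma: "2 * \<gamma> > 1" using k by (simp add: \<gamma>_def)
  \<comment> \<open>The unsimplified exponents match \<open>dilation_correlation\<close> with
    \<open>m = p + 1\<close>, \<open>s = p\<close> for \<open>F\<close> and
    \<open>m = q + 1\<close>, \<open>s = 1\<close> for \<open>G\<close>.\<close>
  define F where "F = (\<lambda>l. LINT x|lborel. u (l *\<^sub>R x) powr p * u x powr (p + 1 - p))"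
  define G where "G = (\<lambda>l. LINT x|lborel. v (l *\<^sub>R x) powr 1 * v x powr (q + 1 - 1))"
  define A where "A = (LINT x|lborel. u x powr (p + 1))"
  define A' where "A' = (LINT x|lborel. v x powr (q + 1))"
  obtain C1 where C1: "C1 > 0"
    "\<And>l. l \<in> {1..2} \<Longrightarrow> integrable lborel (\<lambda>x. u (l *\<^sub>R x) powr p * u x powr (p + 1 - p))"
    "\<And>l. l \<in> {1..2} \<Longrightarrow> \<bar>F l - ((p / (p + 1)) * l powr (- ?n) + (1 - p / (p + 1))) * A\<bar> \<le> C1 * (l - 1) powr (2 * \<gamma>)"
    using dilation_correlation[OF decay(1,2) _ _ int(1) pq(1), of \<gamma>] reg[of k] unfolding \<gamma>_def F_def A_def by auto
  obtain C2 where C2: "C2 > 0"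
    "\<And>l. l \<in> {1..2} \<Longrightarrow> integrable lborel (\<lambda>x. v (l *\<^sub>R x) powr 1 * v x powr (q + 1 - 1))"
    "\<And>l. l \<in> {1..2} \<Longrightarrow> \<bar>G l - ((1 / (q + 1)) * l powr (- ?n) + (1 - 1 / (q + 1))) * A'\<bar> \<le> C2 * (l - 1) powr (2 * \<gamma>)"
    using dilation_correlation[OF decay(3,4) _ _ int(2), of \<gamma> 1] reg[of k] pq unfolding \<gamma>_def G_def A'_def by auto
  have FG: "G l = l powr \<alpha> * F l" if l: "l \<in> {1..2}" for l
  proof -
    have l0: "l > 0" using l by simp
    have "ennreal (F l) = (\<integral>\<^sup>+ x. ennreal (u (l *\<^sub>R x) powr p * u x) \<partial>lborel)"
      unfolding F_def using upos by (subst nn_integral_eq_integral[symmetric, OF C1(2)[OF l]]) (auto simp: less_imp_le)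
    also have "\<dots> = (\<integral>\<^sup>+ x. ennreal (v x powr q * (l powr (\<beta> - ?n) * v (l *\<^sub>R x))) \<partial>lborel)"
      by (rule riesz_symmetric[OF R1 riesz_dilation[OF R2 l0]])
    also have "\<dots> = (\<integral>\<^sup>+ x. ennreal (l powr (\<beta> - ?n) * (v (l *\<^sub>R x) powr 1 * v x powr (q + 1 - 1))) \<partial>lborel)"
      using vpos by (intro nn_integral_cong) (simp add: mult_ac less_imp_le)
    also have "\<dots> = ennreal (l powr (\<beta> - ?n) * G l)"
      unfolding G_def using C2(2)[OF l] by (subst nn_integral_eq_integral) auto
    finally have "ennreal (F l) = ennreal (l powr (\<beta> - ?n) * G l)" .
    moreover have "F l \<ge> 0" "G l \<ge> 0" unfolding F_def G_def by (auto intro!: integral_nonneg_AE)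
    ultimately have "F l = l powr (\<beta> - ?n) * G l" by simp
    then have "l powr \<alpha> * F l = (l powr \<alpha> * l powr (\<beta> - ?n)) * G l" by simp
    also have "l powr \<alpha> * l powr (\<beta> - ?n) = 1" using l0 by (simp add: \<alpha>_def powr_add[symmetric])
    finally show ?thesis by simp
  qed
  \<comment> \<open>At \<open>l = 1\<close> the error terms vanish, so the correlations are the
    energies themselves, and \<open>FG\<close> shows that the two energies coincide.\<close>
  have "A = F 1" "A' = G 1" using C1(3)[of 1] C2(3)[of 1] by auto
  then have AA: "A' = A" using FG[of 1] by simp
  have A0: "A > 0"
  proof (rule has_bochner_integral_lborel_pos)
    show "has_bochner_integral lborel (\<lambda>x. u x powr (p + 1)) A" using int by (simp add: A_def has_bochner_integral_iff)
    show "0 < u x powr (p + 1)" if "x \<in> UNIV" for x using upos[of x] by simp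
  qed auto
  \<comment> \<open>\<open>h\<close> is \<open>l powr \<alpha> * F l - G l\<close>, which is 0, with
    \<open>F\<close> and \<open>G\<close> replaced by their explicit approximations and the common
    energy \<open>A\<close> divided out.\<close>
  define h where "h = (\<lambda>l. l powr \<alpha> * ((p / (p + 1)) * l powr (- ?n) + (1 - p / (p + 1)))
      - ((1 / (q + 1)) * l powr (- ?n) + (1 - 1 / (q + 1))))"
  have "(h has_real_derivative (\<alpha> - (p / (p + 1)) * ?n + (1 / (q + 1)) * ?n)) (at 1)"
  proof -
    have "((\<lambda>l. l powr \<alpha> * (a * l powr (- ?n) + (1 - a)) - (b * l powr (- ?n) + (1 - b)))
        has_real_derivative (\<alpha> - a * ?n + b * ?n)) (at 1)" for a b
      by (auto intro!: derivative_eq_intros simp: algebra_simps)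
    then show ?thesis unfolding h_def .
  qed
  moreover have "\<bar>h l\<bar> \<le> ((2 powr \<alpha> * C1 + C2) / A) * (l - 1) powr (2 * \<gamma>)" if l: "l \<in> {1..2}" for l
  proof -
    define X where "X = F l - ((p / (p + 1)) * l powr (- ?n) + (1 - p / (p + 1))) * A"
    define Y where "Y = G l - ((1 / (q + 1)) * l powr (- ?n) + (1 - 1 / (q + 1))) * A"
    have X: "\<bar>X\<bar> \<le> C1 * (l - 1) powr (2 * \<gamma>)" and Y: "\<bar>Y\<bar> \<le> C2 * (l - 1) powr (2 * \<gamma>)"
      using C1(3)[OF l] C2(3)[OF l] AA by (auto simp: X_def Y_def)
    have "l powr \<alpha> \<le> 2 powr \<alpha>" using l alpha by (intro powr_mono2) auto
    then have "l powr \<alpha> * \<bar>X\<bar> \<le> 2 powr \<alpha> * (C1 * (l - 1) powr (2 * \<gamma>))"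
      using X by (intro mult_mono) auto
    moreover have "h l * A = Y - l powr \<alpha> * X"
      unfolding X_def Y_def h_def FG[OF l] by (simp add: algebra_simps)
    moreover have "\<bar>Y - l powr \<alpha> * X\<bar> \<le> \<bar>Y\<bar> + l powr \<alpha> * \<bar>X\<bar>"
      using abs_triangle_ineq4[of Y "l powr \<alpha> * X"] by (simp add: abs_mult)
    ultimately have "\<bar>h l * A\<bar> \<le> C2 * (l - 1) powr (2 * \<gamma>) + 2 powr \<alpha> * (C1 * (l - 1) powr (2 * \<gamma>))"
      using Y by linarith
    then have "\<bar>h l\<bar> * A \<le> (2 powr \<alpha> * C1 + C2) * (l - 1) powr (2 * \<gamma>)"
      using A0 by (simp add: abs_mult algebra_simps)
    then show ?thesis using A0 by (simp add: field_simps)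
  qed
  ultimately have "\<alpha> - (p / (p + 1)) * ?n + (1 / (q + 1)) * ?n = 0"
    by (rule derivative_zero_if_superlinear[OF _ gamma])
  moreover have "p / (p + 1) = 1 - 1 / (p + 1)" using pq by (simp add: field_simps)
  ultimately have "\<alpha> - (1 - 1 / (p + 1)) * ?n + (1 / (q + 1)) * ?n = 0" by (simp only:)
  then have "?n * (1 / (p + 1) + 1 / (q + 1)) = \<beta>" unfolding \<alpha>_def by (simp add: algebra_simps)
  then show ?thesis using n by (simp add: eq_divide_eq mult.commute)
qed

section \<open>Classification of the decay rates\<close>

text \<open>Inside the ball where the asymptotics say nothing, the upper bound comes from
  boundedness of \<open>u\<close> and the positive lower bound from
  \<open>potential_lower\<close>.\<close>

lemma power_decay_if_asym_equiv:
  fixes u :: "'a::euclidean_space \<Rightarrow> real"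
  assumes "riesz \<beta> f u" "bounded (range u)" "\<theta> \<ge> 0" "asym_equiv u (\<lambda>x. (1 + norm x) powr (- \<theta>))"
  shows "power_decay \<theta> u"
proof -
  interpret riesz \<beta> f u by fact
  obtain C R where C: "C > 0" "\<And>x. norm x \<ge> R \<Longrightarrow> (1 + norm x) powr (- \<theta>) / C \<le> u x"
      "\<And>x. norm x \<ge> R \<Longrightarrow> u x \<le> C * (1 + norm x) powr (- \<theta>)"
    using assms(4) unfolding asym_equiv_def by blast
  obtain M where M: "\<And>x. \<bar>u x\<bar> \<le> M" using assms(2) by (auto simp: bounded_iff)
  obtain b where b: "b > 0" "\<And>x. b * (1 + norm x) powr (- \<beta>) \<le> u x" by (rule potential_lower) blast
  define r where "r = 1 + max R 0"
  have r: "r \<ge> 1" by (simp add: r_def)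
  have M0: "M > 0" using M[of 0] potential_pos[of 0] by linarith
  define c where "c = min (1 / C) (b * r powr (- \<beta>))"
  have "c > 0" using C b r by (simp add: c_def)
  moreover have "c * (1 + norm x) powr (- \<theta>) \<le> u x" for x
  proof (cases "norm x \<ge> R")
    case True
    have "c * (1 + norm x) powr (- \<theta>) \<le> (1 / C) * (1 + norm x) powr (- \<theta>)"
      by (intro mult_right_mono) (auto simp: c_def)
    then show ?thesis using C(2)[OF True] by simp
  next
    case False
    have "(1 + norm x) powr (- \<theta>) \<le> (1 + norm x) powr 0" using assms(3) by (intro powr_mono) auto
    then have "c * (1 + norm x) powr (- \<theta>) \<le> (b * r powr (- \<beta>)) * 1"
      using b r by (intro mult_mono) (auto simp: c_def add_nonneg_eq_0_iff)
    also have "\<dots> \<le> b * (1 + norm x) powr (- \<beta>)"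
      using b False beta unfolding mult_1_right
      by (intro mult_left_mono powr_mono2') (auto simp: r_def intro: add_pos_nonneg)
    finally show ?thesis using b(2)[of x] by linarith
  qed
  moreover define D where "D = C + M * r powr \<theta>"
  have "D > 0" using C M0 r by (auto simp: D_def intro!: add_pos_nonneg)
  moreover have "u x \<le> D * (1 + norm x) powr (- \<theta>)" for x
  proof (cases "norm x \<ge> R")
    case True
    have "C * (1 + norm x) powr (- \<theta>) \<le> D * (1 + norm x) powr (- \<theta>)"
      using M0 by (intro mult_right_mono) (auto simp: D_def)
    then show ?thesis using C(3)[OF True] by linarith
  next
    case False
    then have "r powr (- \<theta>) \<le> (1 + norm x) powr (- \<theta>)"
      using assms(3) by (intro powr_mono2') (auto simp: r_def intro: add_pos_nonneg)
    then have "M * r powr \<theta> * r powr (- \<theta>) \<le> D * (1 + norm x) powr (- \<theta>)"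
      using C M0 r by (intro mult_mono) (auto simp: D_def)
    moreover have "M * r powr \<theta> * r powr (- \<theta>) = M" using r by (simp add: powr_minus)
    ultimately show ?thesis using M[of x] by linarith
  qed
  ultimately show ?thesis unfolding power_decay_def by blast
qed

lemma asym_equiv_if_power_decay:
  fixes v :: "'a::euclidean_space \<Rightarrow> real"
  assumes "power_decay \<theta> v" "\<theta> \<ge> 0" "s = - \<theta>"
  shows "asym_equiv v (\<lambda>x. norm x powr s)"
proof -
  obtain c C where c: "c > 0" "C > 0"
    "\<And>x. norm x \<ge> 1 \<Longrightarrow> c * norm x powr (- \<theta>) \<le> v x"
    "\<And>x. norm x \<ge> 1 \<Longrightarrow> v x \<le> C * norm x powr (- \<theta>)"
    by (rule power_decay_far[OF assms(1,2)]) blast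
  define D where "D = max (1 / c) C"
  have D: "D > 0" "1 / c \<le> D" "C \<le> D" using c by (auto simp: D_def less_max_iff_disj)
  have "norm x powr s / D \<le> v x \<and> v x \<le> D * norm x powr s" if x: "norm x \<ge> 1" for x
  proof
    have "1 / D \<le> c" using D c by (simp add: field_simps)
    then have "(1 / D) * norm x powr s \<le> c * norm x powr s" by (intro mult_right_mono) auto
    then show "norm x powr s / D \<le> v x" using c(3)[OF x] assms(3) by simp
    have "C * norm x powr s \<le> D * norm x powr s" using D by (intro mult_right_mono) auto
    then show "v x \<le> D * norm x powr s" using c(4)[OF x] assms(3) by simp
  qed
  then show ?thesis unfolding asym_equiv_def using D(1) by blast
qed

lemma integrable_powr_if_power_decay:
  fixes v :: "'a::euclidean_space \<Rightarrow> real"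
  assumes "power_decay \<theta> v" "v \<in> borel_measurable borel" "m > 0" "m * \<theta> > DIM('a)"
  shows "integrable lborel (\<lambda>x. v x powr m)"
proof -
  obtain C where C: "C > 0" "\<And>x. v x powr m \<le> C * (1 + norm x) powr (- (m * \<theta>))"
    using power_decay_powr[OF assms(1,3)] unfolding power_decay_def by blast
  have "integrable lborel (\<lambda>x::'a. C * (1 + norm x) powr (- (m * \<theta>)))"
    using integrable_one_plus_norm_powr[OF assms(4)] by simp
  then show ?thesis
  proof (rule Bochner_Integration.integrable_bound)
    show "(\<lambda>x. v x powr m) \<in> borel_measurable lborel" using assms(2) by measurable
  qed (use C in auto)
qed

section \<open>Algebra of the slow decay exponents\<close>

lemma slow_exponent_eq:
  fixes \<alpha> p q s t :: real
  assumes "p * q > 1" "s = q * t - \<alpha>" "t = p * s - \<alpha>"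
  shows "s = \<alpha> * (q + 1) / (p * q - 1)"
proof -
  have "s = q * (p * s - \<alpha>) - \<alpha>" using assms(2,3) by simp
  then have "s * (p * q - 1) = \<alpha> * (q + 1)" by (simp add: algebra_simps)
  then show ?thesis using assms(1) by (simp add: eq_divide_eq)
qed

lemma slow_exponent_le:
  fixes \<alpha> p q s t :: real
  assumes "p * q > 1" "q > 0" "s \<le> q * t - \<alpha>" "t \<le> p * s - \<alpha>"
  shows "s \<ge> \<alpha> * (q + 1) / (p * q - 1)"
proof -
  have "q * t \<le> q * (p * s - \<alpha>)" using assms by (intro mult_left_mono) auto
  then have "s \<le> q * (p * s - \<alpha>) - \<alpha>" using assms(3) by simp
  then have "\<alpha> * (q + 1) \<le> s * (p * q - 1)" by (simp add: algebra_simps)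
  then show ?thesis using assms(1) by (simp add: divide_le_eq)
qed

text \<open>Since \<open>(p * q - 1) + (p + q + 2) = (p + 1) * (q + 1)\<close>, adding
  \<open>(N - \<alpha>) * (p + q + 2)\<close> to both sides of the cleared inequality turns it into
  the condition on the exponents.\<close>

lemma subcritical_if_slow_sum_le:
  fixes N \<alpha> p q :: real
  assumes "N > 0" "p > 0" "q > 0" "p * q > 1"
    and "\<alpha> * (q + 1) / (p * q - 1) + \<alpha> * (p + 1) / (p * q - 1) \<le> N - \<alpha>"
  shows "1 / (p + 1) + 1 / (q + 1) \<le> (N - \<alpha>) / N"
proof -
  have "(\<alpha> * (q + 1) + \<alpha> * (p + 1)) / (p * q - 1) \<le> N - \<alpha>" using assms(5) by (simp add: add_divide_distrib)
  then have "\<alpha> * (q + 1) + \<alpha> * (p + 1) \<le> (N - \<alpha>) * (p * q - 1)" using assms(4) by (simp add: divide_le_eq)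
  then have "N * (p + q + 2) \<le> (N - \<alpha>) * ((p + 1) * (q + 1))" by (simp add: algebra_simps)
  then have "(p + q + 2) / ((p + 1) * (q + 1)) \<le> (N - \<alpha>) / N"
    using assms by (simp add: divide_le_eq le_divide_eq mult.commute)
  moreover have "1 / (p + 1) + 1 / (q + 1) = (p + q + 2) / ((p + 1) * (q + 1))"
    using assms by (simp add: field_simps)
  ultimately show ?thesis by simp
qed

theorem theorem1p4:
  fixes u v :: "real^'n \<Rightarrow> real" and \<alpha> p q \<theta>1 \<theta>2 :: real
  defines "N \<equiv> real CARD('n)"
  assumes n3: "CARD('n) \<ge> 3"
    and \<alpha>: "0 < \<alpha>" "\<alpha> < N"
    and pq: "p > 0" "q > 0" "p * q > 1"
    and sol: "pos_solution \<alpha> p q u v"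
    and bdd: "bounded (range u)" "bounded (range v)"
    and th: "\<theta>1 > 0" "\<theta>2 > 0"
    and asu: "asym_equiv u (\<lambda>x. (1 + norm x) powr (- \<theta>1))"
    and asv: "asym_equiv v (\<lambda>x. (1 + norm x) powr (- \<theta>2))"
  shows "1 / (p + 1) + 1 / (q + 1) \<le> (N - \<alpha>) / N
    \<and> \<theta>1 \<ge> \<alpha> * (q + 1) / (p * q - 1)
    \<and> \<theta>2 \<ge> \<alpha> * (p + 1) / (p * q - 1)
    \<and> (\<theta>1 > \<alpha> * (q + 1) / (p * q - 1) \<or> \<theta>2 > \<alpha> * (p + 1) / (p * q - 1) \<longrightarrow>
           1 / (p + 1) + 1 / (q + 1) = (N - \<alpha>) / N
         \<and> integrable lborel (\<lambda>x. u x powr (p + 1))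
         \<and> integrable lborel (\<lambda>x. v x powr (q + 1))
         \<and> (p \<le> q \<longrightarrow>
              asym_equiv u (\<lambda>x. norm x powr (\<alpha> - N))
            \<and> (p * (N - \<alpha>) > N \<longrightarrow> asym_equiv v (\<lambda>x. norm x powr (\<alpha> - N)))
            \<and> (p * (N - \<alpha>) = N \<longrightarrow> asym_equiv v (\<lambda>x. norm x powr (\<alpha> - N) * ln (norm x)))
            \<and> (p * (N - \<alpha>) < N \<longrightarrow> asym_equiv v (\<lambda>x. norm x powr ((\<alpha> - N) * (p + 1) + N))))
         \<and> (q \<le> p \<longrightarrow>
              asym_equiv v (\<lambda>x. norm x powr (\<alpha> - N))
            \<and> (q * (N - \<alpha>) > N \<longrightarrow> asym_equiv u (\<lambda>x. norm x powr (\<alpha> - N)))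
            \<and> (q * (N - \<alpha>) = N \<longrightarrow> asym_equiv u (\<lambda>x. norm x powr (\<alpha> - N) * ln (norm x)))
            \<and> (q * (N - \<alpha>) < N \<longrightarrow> asym_equiv u (\<lambda>x. norm x powr ((\<alpha> - N) * (q + 1) + N)))))
    \<and> (1 / (p + 1) + 1 / (q + 1) < (N - \<alpha>) / N \<longrightarrow>
           \<theta>1 = \<alpha> * (q + 1) / (p * q - 1) \<and> \<theta>2 = \<alpha> * (p + 1) / (p * q - 1))"
proof -
  have card: "real DIM(real^'n) = N" by (simp add: N_def)
  note S = sol[unfolded pos_solution_def riesz_pot_def N_def[symmetric]]
  have "u \<in> borel_measurable lborel" "v \<in> borel_measurable lborel" using S by blast+
  then have meas: "u \<in> borel_measurable borel" "v \<in> borel_measurable borel" by simp_all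
  have pos: "\<And>x. u x > 0" "\<And>x. v x > 0" using S by blast+
  note S5 = S[THEN conjunct2, THEN conjunct2, THEN conjunct2, THEN conjunct2, THEN conjunct1, rule_format]
  note S6 = S[THEN conjunct2, THEN conjunct2, THEN conjunct2, THEN conjunct2, THEN conjunct2, rule_format]
  have pot: "has_bochner_integral lborel (\<lambda>y. v y powr q * norm (x - y) powr (- (N - \<alpha>))) (u x)"
    "has_bochner_integral lborel (\<lambda>y. u y powr p * norm (x - y) powr (- (N - \<alpha>))) (v x)" for x
    using S5[of x] S6[of x]
    by (simp_all only: has_bochner_integral_iff powr_minus_divide times_divide_eq_right mult_1_right simp_thms)
  have R1: "riesz (N - \<alpha>) (\<lambda>y. v y powr q) u"
    by unfold_locales (use \<alpha> card meas pot(1) less_imp_neq[OF pos(2)] in \<open>auto simp del: minus_diff_eq\<close>)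
  have R2: "riesz (N - \<alpha>) (\<lambda>y. u y powr p) v"
    by unfold_locales (use \<alpha> card meas pot(2) less_imp_neq[OF pos(1)] in \<open>auto simp del: minus_diff_eq\<close>)
  have du: "power_decay \<theta>1 u" by (rule power_decay_if_asym_equiv[OF R1 bdd(1) _ asu]) (use th in simp)
  have dv: "power_decay \<theta>2 v" by (rule power_decay_if_asym_equiv[OF R2 bdd(2) _ asv]) (use th in simp)
  have E1: "q * \<theta>2 < N \<and> \<theta>1 = q * \<theta>2 - \<alpha> \<or> q * \<theta>2 > N \<and> \<theta>1 = N - \<alpha>"
    using riesz.decay_exponent[OF R1 power_decay_powr[OF dv pq(2)] _ du th(1)] pq th card by auto
  have E2: "p * \<theta>1 < N \<and> \<theta>2 = p * \<theta>1 - \<alpha> \<or> p * \<theta>1 > N \<and> \<theta>2 = N - \<alpha>"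
    using riesz.decay_exponent[OF R2 power_decay_powr[OF du pq(1)] _ dv th(2)] pq th card by auto
  have int_u: "integrable lborel (\<lambda>x. u x powr (p + 1))" if "(p + 1) * \<theta>1 > N"
    by (rule integrable_powr_if_power_decay[OF du meas(1)]) (use that pq card in auto)
  have int_v: "integrable lborel (\<lambda>x. v x powr (q + 1))" if "(q + 1) * \<theta>2 > N"
    by (rule integrable_powr_if_power_decay[OF dv meas(2)]) (use that pq card in auto)
  have crit: "1 / (p + 1) + 1 / (q + 1) = (N - \<alpha>) / N" if "(p + 1) * \<theta>1 > N" "(q + 1) * \<theta>2 > N"
    using pohozaev_critical[OF R1 R2 meas pq(1,2) du _ dv _ int_u int_v] that th card by simp
  have asym_u: "asym_equiv u (\<lambda>x. norm x powr s)" if "s = - \<theta>1" for s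
    by (rule asym_equiv_if_power_decay[OF du _ that]) (use th in simp)
  have asym_v: "asym_equiv v (\<lambda>x. norm x powr s)" if "s = - \<theta>2" for s
    by (rule asym_equiv_if_power_decay[OF dv _ that]) (use th in simp)
  have qp: "q * p > 1" using pq by (simp add: mult.commute)
  \<comment> \<open>Both alternatives of \<open>E1\<close> give
    \<open>\<theta>1 \<le> q * \<theta>2 - \<alpha>\<close>: the slow one with equality, the fast
    one because \<open>N < q * \<theta>2\<close>. The same holds for \<open>E2\<close>.\<close>
  have le1: "\<theta>1 \<ge> \<alpha> * (q + 1) / (p * q - 1)"
    by (rule slow_exponent_le[OF pq(3,2), of _ \<theta>2]) (use E1 E2 in auto)
  have le2: "\<theta>2 \<ge> \<alpha> * (p + 1) / (p * q - 1)"
    using slow_exponent_le[OF qp pq(1), of \<theta>2 \<theta>1 \<alpha>] E1 E2 by (auto simp: mult.commute)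
  show ?thesis
  proof (cases "q * \<theta>2 < N \<and> p * \<theta>1 < N")
    case True
    then have slow: "\<theta>1 = q * \<theta>2 - \<alpha>" "\<theta>2 = p * \<theta>1 - \<alpha>" using E1 E2 by auto
    have eq1: "\<theta>1 = \<alpha> * (q + 1) / (p * q - 1)" by (rule slow_exponent_eq[OF pq(3) slow])
    have eq2: "\<theta>2 = \<alpha> * (p + 1) / (p * q - 1)"
      using slow_exponent_eq[OF qp slow(2,1)] by (simp add: mult.commute)
    have "1 / (p + 1) + 1 / (q + 1) \<le> (N - \<alpha>) / N"
    proof (cases "\<theta>1 + \<theta>2 \<le> N - \<alpha>")
      case True
      then show ?thesis
        using subcritical_if_slow_sum_le[of N p q \<alpha>] \<alpha> pq eq1 eq2 by simp
    next
      case False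
      \<comment> \<open>Both left sides equal
        \<open>\<theta>1 + \<theta>2 + \<alpha>\<close>.\<close>
      then have "(p + 1) * \<theta>1 > N" "(q + 1) * \<theta>2 > N" using slow unfolding distrib_right by linarith+
      then show ?thesis using crit by simp
    qed
    then show ?thesis using eq1 eq2 by simp
  next
    case False
    \<comment> \<open>If only \<open>\<theta>1\<close> is fast, then \<open>(p + 1) * \<theta>1 =
      (\<theta>2 + \<alpha>) + (N - \<alpha>) = N + \<theta>2\<close>, which exceeds
      \<open>N\<close>; the other energy already has \<open>q * \<theta>2 > N\<close>. The mirrored
      case is alike.\<close>
    have fast: "(p + 1) * \<theta>1 > N" "(q + 1) * \<theta>2 > N"
      using False E1 E2 th unfolding distrib_right by linarith+
    note critical = crit[OF fast]
    have not_slow: "\<not> (1 / (p + 1) + 1 / (q + 1) < (N - \<alpha>) / N)" using critical by simp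
    \<comment> \<open>Once \<open>\<theta>1 = N - \<alpha>\<close>, the alternatives in
      \<open>E2\<close> exclude \<open>p * (N - \<alpha>) = N\<close>, so the logarithmic clause of
      the theorem holds vacuously under pure power decay.\<close>
    have u_fast: "\<theta>1 = N - \<alpha> \<and> (p * (N - \<alpha>) > N \<longrightarrow> \<theta>2 = N - \<alpha>) \<and> p * (N - \<alpha>) \<noteq> N
        \<and> (p * (N - \<alpha>) < N \<longrightarrow> - \<theta>2 = (\<alpha> - N) * (p + 1) + N)" if "p \<le> q"
    proof -
      have "\<theta>1 = N - \<alpha>"
      proof (rule ccontr)
        assume "\<theta>1 \<noteq> N - \<alpha>"
        \<comment> \<open>Here \<open>\<theta>1 = q * \<theta>2 - \<alpha> < N - \<alpha> =
          \<theta>2\<close>; with \<open>p \<le> q\<close> this gives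
          \<open>N < p * \<theta>1 \<le> q * \<theta>2 < N\<close>.\<close>
        then have h: "q * \<theta>2 < N" "\<theta>1 = q * \<theta>2 - \<alpha>" "p * \<theta>1 > N" "\<theta>2 = N - \<alpha>" using E1 E2 False by blast+
        then have "p * \<theta>1 \<le> q * \<theta>2" using that pq th by (intro mult_mono) auto
        then show False using h by simp
      qed
      then show ?thesis using E2 by (auto simp: algebra_simps)
    qed
    have v_fast: "\<theta>2 = N - \<alpha> \<and> (q * (N - \<alpha>) > N \<longrightarrow> \<theta>1 = N - \<alpha>) \<and> q * (N - \<alpha>) \<noteq> N
        \<and> (q * (N - \<alpha>) < N \<longrightarrow> - \<theta>1 = (\<alpha> - N) * (q + 1) + N)" if "q \<le> p"
    proof -
      have "\<theta>2 = N - \<alpha>"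
      proof (rule ccontr)
        assume "\<theta>2 \<noteq> N - \<alpha>"
        then have h: "p * \<theta>1 < N" "\<theta>2 = p * \<theta>1 - \<alpha>" "q * \<theta>2 > N" "\<theta>1 = N - \<alpha>" using E1 E2 False by blast+
        then have "q * \<theta>2 \<le> p * \<theta>1" using that pq th by (intro mult_mono) auto
        then show False using h by simp
      qed
      then show ?thesis using E1 by (auto simp: algebra_simps)
    qed
    show ?thesis
      using critical not_slow le1 le2 int_u[OF fast(1)] int_v[OF fast(2)] u_fast v_fast
      by (intro conjI impI asym_u asym_v) auto
  qed
qed

end
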